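(* Let $G\subset\mathbb{R}^N$ be a bounded open domain. Let $\varphi:G\times\mathbb{R}\to[0,+\infty)$ be a measurable-convex integrand with $\varphi(x,0)=0$ for each $x\in G$, and let $\bar\beta(x,\cdot)=\partial\varphi(x,\cdot)$ be the subgradient of $\varphi(x,\cdot)$ for each $x\in G$. Assume that for each $C>0$ the function $$M_C(x)=\sup\{|u|:\ u\in\bar\beta(x,v),\ |v|\le C\}$$ belongs to $L^2(G)$. Let $A:\mathrm{Dom}(A)\subset L^1(G)\to L^1(G)$ be a linear operator such that: (a) $\mathrm{Dom}(A)$ is dense in $L^1(G)$ and $(I+\lambda A)^{-1}$ is a contraction on $L^1(G)$ for each $\lambda>0$; (b) there is a $c>0$ such that $c\|v\|_{L^1}\le\|Av\|_{L^1}$ for all $v\in\mathrm{Dom}(A)$; (c) $\sup_G (I+\lambda A)^{-1}f\le(\sup_G f)^+$ for each $f\in L^1(G)$ and $\lambda>0$. Then for each $f\in L^1(G)$ there is a unique pair $v\in\mathrm{Dom}(A)$, $u\in L^1(G)$ satisfying $$u+Av=f\quad\text{and}\quad u(x)\in\bar\beta(x,v(x))\ \text{ for a.e. } x\in G.$$ In addition, if $(u_1,v_1)$ and $(u_2,v_2)$ are the solutions corresponding to $f_1,f_2\in L^1(G)$, then $$\|(u_1-u_2)^+\|_{L^1}\le\|(f_1-f_2)^+\|_{L^1},\qquad \|(u_1-u_2)^-\|_{L^1}\le\|(f_1-f_2)^-\|_{L^1},$$ and consequently $\|u_1-u_2\|_{L^1}\le\|f_1-f_2\|_{L^1}$, i.e.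 the map $f\mapsto u$ is a contraction on $L^1(G)$.
   Context: A function $\varphi:G\times\mathbb{R}\to(-\infty,+\infty]$ is a measurable-convex integrand if for each $x\in G$ the function $\varphi(x,\cdot)$ is proper, lower semicontinuous and convex, and for each $\xi\in\mathbb{R}$ the function $x\mapsto\varphi(x,\xi)$ is measurable. The subgradient $\partial\varphi(x,\cdot)$ is taken in the second variable: $u^*\in\partial\varphi(x,v)$ iff $u^*(w-v)\le\varphi(x,w)-\varphi(x,v)$ for all $w\in\mathbb{R}$; it is in general multivalued. "Contraction" means nonexpansive (Lipschitz with constant at most 1), and in (a) the inverse $(I+\lambda A)^{-1}$ is defined on all of $L^1(G)$. $\sup_G$ denotes the essential supremum (possibly $+\infty$); $r^+=\max(r,0)$, $r^-=\max(-r,0)$. *)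

theory Defs
  imports "HOL-Analysis.Analysis" "HOL-Probability.Essential_Supremum"
begin

section \<open>Convex integrands and subgradients\<close>

definition proper_ereal :: "(real \<Rightarrow> ereal) \<Rightarrow> bool" where
  "proper_ereal f \<longleftrightarrow> (\<forall>v. f v \<noteq> -\<infinity>) \<and> (\<exists>v. f v \<noteq> \<infinity>)"

definition lsc :: "(real \<Rightarrow> ereal) \<Rightarrow> bool" where
  "lsc f \<longleftrightarrow> (\<forall>v. f v \<le> Liminf (at v) f)"

definition convex_ereal :: "(real \<Rightarrow> ereal) \<Rightarrow> bool" where
  "convex_ereal f \<longleftrightarrow>
     (\<forall>v w t. 0 < t \<and> t < 1 \<longrightarrow>
        f ((1 - t) * v + t * w) \<le> ereal (1 - t) * f v + ereal t * f w)"

definition measurable_convex_integrand ::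
    "'a::euclidean_space set \<Rightarrow> ('a \<Rightarrow> real \<Rightarrow> ereal) \<Rightarrow> bool" where
  "measurable_convex_integrand G \<phi> \<longleftrightarrow>
     (\<forall>x\<in>G. proper_ereal (\<phi> x) \<and> lsc (\<phi> x) \<and> convex_ereal (\<phi> x)) \<and>
     (\<forall>\<xi>. (\<lambda>x. \<phi> x \<xi>) \<in> borel_measurable (lebesgue_on G))"

definition subgradient :: "(real \<Rightarrow> ereal) \<Rightarrow> real \<Rightarrow> real set" where
  "subgradient f v = {u. \<forall>w. ereal (u * (w - v)) \<le> f w - f v}"

text \<open>The supremum of \<open>\<bar>u\<bar>\<close> is taken in \<^typ>\<open>ennreal\<close>, so that an unbounded family yields \<open>\<infinity>\<close>
  rather than an unspecified real number.\<close>

definition subgradient_bound :: "('a \<Rightarrow> real \<Rightarrow> ereal) \<Rightarrow> real \<Rightarrow> 'a \<Rightarrow> ennreal" where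
  "subgradient_bound \<phi> C x = Sup {ennreal \<bar>u\<bar> | u v. u \<in> subgradient (\<phi> x) v \<and> \<bar>v\<bar> \<le> C}"

definition nonneg_L2 :: "'a::euclidean_space set \<Rightarrow> ('a \<Rightarrow> ennreal) \<Rightarrow> bool" where
  "nonneg_L2 G M \<longleftrightarrow> M \<in> borel_measurable (lebesgue_on G) \<and>
     (\<integral>\<^sup>+ x. (M x)\<^sup>2 \<partial>lebesgue_on G) < \<infinity>"


section \<open>Operators in the space of integrable functions\<close>

text \<open>Elements of \<open>L\<^sup>1(G)\<close> are handled through representatives; equality in \<open>L\<^sup>1(G)\<close> is equality
  almost everywhere, and domains and operators are required to be compatible with it.\<close>

definition L1 :: "'a::euclidean_space set \<Rightarrow> ('a \<Rightarrow> real) set" where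
  "L1 G = {f. integrable (lebesgue_on G) f}"

definition L1norm :: "'a::euclidean_space set \<Rightarrow> ('a \<Rightarrow> real) \<Rightarrow> real" where
  "L1norm G f = (\<integral>x. \<bar>f x\<bar> \<partial>lebesgue_on G)"

definition eq_L1 :: "'a::euclidean_space set \<Rightarrow> ('a \<Rightarrow> real) \<Rightarrow> ('a \<Rightarrow> real) \<Rightarrow> bool" where
  "eq_L1 G f g \<longleftrightarrow> (AE x in lebesgue_on G. f x = g x)"

definition linear_operator_L1 ::
    "'a::euclidean_space set \<Rightarrow> ('a \<Rightarrow> real) set \<Rightarrow> (('a \<Rightarrow> real) \<Rightarrow> 'a \<Rightarrow> real) \<Rightarrow> bool" where
  "linear_operator_L1 G D A \<longleftrightarrow>
     D \<subseteq> L1 G \<and> (\<forall>v\<in>D. A v \<in> L1 G) \<and>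
     (\<forall>v\<in>D. \<forall>w\<in>L1 G. eq_L1 G v w \<longrightarrow> w \<in> D \<and> eq_L1 G (A v) (A w)) \<and>
     (\<lambda>x. 0) \<in> D \<and>
     (\<forall>v\<in>D. \<forall>w\<in>D. (\<lambda>x. v x + w x) \<in> D \<and> eq_L1 G (A (\<lambda>x. v x + w x)) (\<lambda>x. A v x + A w x)) \<and>
     (\<forall>v\<in>D. \<forall>a. (\<lambda>x. a * v x) \<in> D \<and> eq_L1 G (A (\<lambda>x. a * v x)) (\<lambda>x. a * A v x))"

definition dense_L1 :: "'a::euclidean_space set \<Rightarrow> ('a \<Rightarrow> real) set \<Rightarrow> bool" where
  "dense_L1 G D \<longleftrightarrow> D \<subseteq> L1 G \<and> (\<forall>f\<in>L1 G. \<forall>\<epsilon>>0. \<exists>v\<in>D. L1norm G (\<lambda>x. f x - v x) < \<epsilon>)"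

text \<open>\<open>resolvent_L1 G D A r f v\<close> expresses \<open>v = (I + r A)\<^sup>-\<^sup>1 f\<close>, as a relation.\<close>

definition resolvent_L1 ::
    "'a::euclidean_space set \<Rightarrow> ('a \<Rightarrow> real) set \<Rightarrow> (('a \<Rightarrow> real) \<Rightarrow> 'a \<Rightarrow> real) \<Rightarrow> real \<Rightarrow>
       ('a \<Rightarrow> real) \<Rightarrow> ('a \<Rightarrow> real) \<Rightarrow> bool" where
  "resolvent_L1 G D A r f v \<longleftrightarrow> v \<in> D \<and> eq_L1 G (\<lambda>x. v x + r * A v x) f"

text \<open>The three clauses: the relation is everywhere defined, single-valued, and nonexpansive.\<close>

definition resolvent_contraction_L1 ::
    "'a::euclidean_space set \<Rightarrow> ('a \<Rightarrow> real) set \<Rightarrow> (('a \<Rightarrow> real) \<Rightarrow> 'a \<Rightarrow> real) \<Rightarrow> real \<Rightarrow> bool" where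
  "resolvent_contraction_L1 G D A r \<longleftrightarrow>
     (\<forall>f\<in>L1 G. \<exists>v. resolvent_L1 G D A r f v) \<and>
     (\<forall>f\<in>L1 G. \<forall>v w. resolvent_L1 G D A r f v \<and> resolvent_L1 G D A r f w \<longrightarrow> eq_L1 G v w) \<and>
     (\<forall>f\<in>L1 G. \<forall>g\<in>L1 G. \<forall>v w. resolvent_L1 G D A r f v \<and> resolvent_L1 G D A r g w \<longrightarrow>
        L1norm G (\<lambda>x. v x - w x) \<le> L1norm G (\<lambda>x. f x - g x))"

definition solves ::
    "'a::euclidean_space set \<Rightarrow> ('a \<Rightarrow> real \<Rightarrow> ereal) \<Rightarrow> ('a \<Rightarrow> real) set \<Rightarrow>
       (('a \<Rightarrow> real) \<Rightarrow> 'a \<Rightarrow> real) \<Rightarrow> ('a \<Rightarrow> real) \<Rightarrow> ('a \<Rightarrow> real) \<Rightarrow> ('a \<Rightarrow> real) \<Rightarrow> bool" where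
  "solves G \<phi> D A f u v \<longleftrightarrow>
     v \<in> D \<and> u \<in> L1 G \<and> eq_L1 G (\<lambda>x. u x + A v x) f \<and>
     (AE x in lebesgue_on G. u x \<in> subgradient (\<phi> x) (v x))"

end

theory Submission
  imports Defs
begin

text \<open>
  If \<open>v \<in> D\<close> and \<open>g\<close> is a measurable section of the Heaviside graph of \<open>v - t\<close> with \<open>t \<ge> 0\<close>, then
  \<open>\<integral> A v g \<ge> 0\<close>: for the resolvents this is positivity and contraction, and density of the domain
  allows the passage to the limit. With \<open>t = 0\<close> and \<open>v = v\<^sub>1 - v\<^sub>2\<close>, where the values of \<open>g\<close> on
  \<open>{v = 0}\<close> are chosen according to the sign of \<open>u\<^sub>1 - u\<^sub>2\<close>, this gives the comparison inequalities, hence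
  uniqueness by coercivity; summing over levels \<open>t\<close> gives \<open>\<integral> A v v \<ge> 0\<close> for bounded \<open>v\<close>.

  For existence, \<open>e v + \<beta>\<^sub>\<lambda>(v) + A v = f\<close> with the Yosida approximation \<open>\<beta>\<^sub>\<lambda>\<close> is a Banach fixed point
  problem. For bounded \<open>f\<close> the solutions satisfy \<open>\<bar>v\<bar> \<le> \<parallel>f\<parallel>\<^sub>\<infinity> / e\<close>, so that \<open>u\<^sub>\<lambda> = \<beta>\<^sub>\<lambda>(v)\<close> is dominated in
  \<open>L\<^sup>2\<close>. Monotonicity yields \<open>\<integral> (u\<^sub>\<lambda> - u\<^sub>\<mu>) (\<lambda> u\<^sub>\<lambda> - \<mu> u\<^sub>\<mu>) \<le> 0\<close>, so \<open>u\<^sub>\<lambda>\<close> converges strongly in \<open>L\<^sup>2\<close> as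
  \<open>\<lambda> \<longrightarrow> 0\<close>. Finally \<open>e \<longrightarrow> 0\<close> and truncations of \<open>f\<close> are handled by the contraction
  property and coercivity.
\<close>

section \<open>Completeness of \<open>L\<^sup>1\<close> in terms of representatives\<close>

lemma L1_triangle:
  fixes f g h :: "'a \<Rightarrow> real"
  assumes [measurable]: "integrable M f" "integrable M g" "integrable M h"
  shows "(\<integral>x. \<bar>f x - h x\<bar> \<partial>M) \<le> (\<integral>x. \<bar>f x - g x\<bar> \<partial>M) + (\<integral>x. \<bar>g x - h x\<bar> \<partial>M)"
proof -
  have "(\<integral>x. \<bar>f x - h x\<bar> \<partial>M) \<le> (\<integral>x. \<bar>f x - g x\<bar> + \<bar>g x - h x\<bar> \<partial>M)"
    by (rule integral_mono) (use assms in auto)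
  also have "\<dots> = (\<integral>x. \<bar>f x - g x\<bar> \<partial>M) + (\<integral>x. \<bar>g x - h x\<bar> \<partial>M)"
    by (rule Bochner_Integration.integral_add) (use assms in auto)
  finally show ?thesis .
qed

lemma L1_diff_commute:
  fixes f g :: "'a \<Rightarrow> real"
  shows "(\<integral>x. \<bar>f x - g x\<bar> \<partial>M) = (\<integral>x. \<bar>g x - f x\<bar> \<partial>M)"
  by (simp add: abs_minus_commute)

lemma L1_zero_AE_eq:
  fixes f g :: "'a \<Rightarrow> real"
  assumes "integrable M f" "integrable M g" "(\<integral>x. \<bar>f x - g x\<bar> \<partial>M) \<le> 0"
  shows "AE x in M. f x = g x"
proof -
  have "(\<integral>x. \<bar>f x - g x\<bar> \<partial>M) = 0"
    by (rule antisym[OF assms(3)]) simp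
  moreover have "integrable M (\<lambda>x. \<bar>f x - g x\<bar>)" using assms by auto
  ultimately have "AE x in M. \<bar>f x - g x\<bar> = 0"
    by (subst (asm) integral_nonneg_eq_0_iff_AE) auto
  then show ?thesis by eventually_elim simp
qed

text \<open>Interchanging sum and integral makes the telescoping series absolutely summable almost
  everywhere. The sum \<open>W\<close> of the absolute steps is an integrable majorant, so dominated
  convergence applies to the partial sums.\<close>

lemma L1_limit_of_summable_steps:
  fixes f :: "nat \<Rightarrow> 'a \<Rightarrow> real"
  assumes f: "\<And>n. integrable M (f n)"
    and steps: "summable (\<lambda>n. \<integral>x. \<bar>f (Suc n) x - f n x\<bar> \<partial>M)"
  shows "\<exists>g. integrable M g \<and> (\<lambda>n. \<integral>x. \<bar>f n x - g x\<bar> \<partial>M) \<longlonglongrightarrow> 0"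
proof -
  define d where "d = (\<lambda>n x. f (Suc n) x - f n x)"
  have d: "integrable M (d n)" for n
    unfolding d_def using f by auto
  have d_abs: "integrable M (\<lambda>x. \<bar>d n x\<bar>)" for n
    using d by auto
  have sum_d: "summable (\<lambda>n. \<integral>x. \<bar>d n x\<bar> \<partial>M)"
    using steps unfolding d_def .
  have "(\<integral>\<^sup>+x. (\<Sum>n. ennreal \<bar>d n x\<bar>) \<partial>M) = (\<Sum>n. \<integral>\<^sup>+x. ennreal \<bar>d n x\<bar> \<partial>M)"
    by (rule nn_integral_suminf) (use d in auto)
  also have "\<dots> = (\<Sum>n. ennreal (\<integral>x. \<bar>d n x\<bar> \<partial>M))"
    by (subst nn_integral_eq_integral[OF d_abs]) auto
  also have "\<dots> = ennreal (\<Sum>n. \<integral>x. \<bar>d n x\<bar> \<partial>M)"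
    by (rule suminf_ennreal2[OF _ sum_d]) simp
  finally have "(\<integral>\<^sup>+x. (\<Sum>n. ennreal \<bar>d n x\<bar>) \<partial>M) \<noteq> \<infinity>" by simp
  then have "AE x in M. (\<Sum>n. ennreal \<bar>d n x\<bar>) \<noteq> \<infinity>"
    by (intro nn_integral_PInf_AE) (use d in auto)
  then have ae: "AE x in M. summable (\<lambda>n. \<bar>d n x\<bar>)"
    by eventually_elim (rule summable_suminf_not_top, auto)
  define g where "g = (\<lambda>x. f 0 x + (\<Sum>n. d n x))"
  define W where "W = (\<lambda>x. \<Sum>n. \<bar>d n x\<bar>)"
  have "integrable M (\<lambda>x. \<Sum>n. d n x)"
    by (rule integrable_suminf[OF d]) (use ae sum_d in auto)
  then have g: "integrable M g" unfolding g_def using f by auto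
  have W: "integrable M W"
    unfolding W_def by (rule integrable_suminf[OF d_abs]) (use ae sum_d in auto)
  have f_eq: "f n x = f 0 x + (\<Sum>i<n. d i x)" for n x
    unfolding d_def by (subst sum_lessThan_telescope) simp
  have "(\<lambda>n. \<integral>x. \<bar>f n x - g x\<bar> \<partial>M) \<longlonglongrightarrow> (\<integral>x. 0 \<partial>M)"
  proof (rule integral_dominated_convergence[OF _ _ W])
    show "AE x in M. (\<lambda>n. \<bar>f n x - g x\<bar>) \<longlonglongrightarrow> 0"
      using ae
    proof eventually_elim
      case (elim x)
      then have "summable (\<lambda>n. d n x)" by (rule summable_rabs_cancel)
      then have "(\<lambda>n. \<Sum>i<n. d i x) \<longlonglongrightarrow> (\<Sum>i. d i x)" by (rule summable_LIMSEQ)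
      then have "(\<lambda>n. \<bar>(\<Sum>i<n. d i x) - (\<Sum>i. d i x)\<bar>) \<longlonglongrightarrow> 0"
        by (simp add: LIM_zero tendsto_rabs_zero)
      then show ?case unfolding g_def by (subst f_eq) simp
    qed
    show "AE x in M. norm \<bar>f n x - g x\<bar> \<le> W x" for n
      using ae
    proof eventually_elim
      case (elim x)
      then have *: "summable (\<lambda>n. d n x)" by (rule summable_rabs_cancel)
      have "f n x - g x = - (\<Sum>i. d (i + n) x)"
        unfolding g_def using suminf_split_initial_segment[OF *, of n]
        by (subst f_eq) simp
      moreover have "\<bar>\<Sum>i. d (i + n) x\<bar> \<le> (\<Sum>i. \<bar>d (i + n) x\<bar>)"
        using elim by (intro summable_rabs) (simp add: summable_iff_shift[of "\<lambda>i. \<bar>d i x\<bar>"])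
      moreover have "(\<Sum>i. \<bar>d (i + n) x\<bar>) \<le> W x"
        unfolding W_def using suminf_split_initial_segment[OF elim, of n] by (simp add: sum_nonneg)
      ultimately show ?case by simp
    qed
  qed (use f g in auto)
  then show ?thesis using g by auto
qed

text \<open>A subsequence with steps below \<open>(1/2)^k\<close> converges by the summable case,
  and the Cauchy property carries its limit over to the whole sequence.\<close>

lemma L1_complete:
  fixes f :: "nat \<Rightarrow> 'a \<Rightarrow> real"
  assumes f: "\<And>n. integrable M (f n)"
    and cauchy: "\<And>e. e > 0 \<Longrightarrow> \<exists>N. \<forall>m\<ge>N. \<forall>n\<ge>N. (\<integral>x. \<bar>f m x - f n x\<bar> \<partial>M) < e"
  shows "\<exists>g. integrable M g \<and> (\<lambda>n. \<integral>x. \<bar>f n x - g x\<bar> \<partial>M) \<longlonglongrightarrow> 0"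
proof -
  have "\<exists>N. \<forall>m\<ge>N. \<forall>n\<ge>N. (\<integral>x. \<bar>f m x - f n x\<bar> \<partial>M) < (1/2)^k" for k :: nat
    by (rule cauchy) simp
  then obtain N where N: "\<And>k m n. m \<ge> N k \<Longrightarrow> n \<ge> N k \<Longrightarrow> (\<integral>x. \<bar>f m x - f n x\<bar> \<partial>M) < (1/2)^k"
    by metis
  \<comment> \<open>Adding up the thresholds makes \<open>r\<close> nondecreasing with
    \<open>r k \<ge> N k\<close>, so both indices of the \<open>k\<close>-th step lie beyond
    \<open>N k\<close>.\<close>
  define r where "r = (\<lambda>k. \<Sum>i\<le>k. N i)"
  have r_ge: "r k \<ge> N k" for k
    unfolding r_def by (rule member_le_sum) auto
  have r_Suc: "r (Suc k) \<ge> r k" for k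
    unfolding r_def by simp
  have "summable (\<lambda>k. \<integral>x. \<bar>f (r (Suc k)) x - f (r k) x\<bar> \<partial>M)"
  proof (rule summable_comparison_test)
    show "\<exists>N. \<forall>n\<ge>N. norm (\<integral>x. \<bar>f (r (Suc n)) x - f (r n) x\<bar> \<partial>M) \<le> (1/2)^n"
      using N[OF order.trans[OF r_ge r_Suc] r_ge] by (auto intro: less_imp_le)
    show "summable (\<lambda>n. (1/2::real)^n)" by (rule summable_geometric) simp
  qed
  then obtain g where g: "integrable M g" "(\<lambda>k. \<integral>x. \<bar>f (r k) x - g x\<bar> \<partial>M) \<longlonglongrightarrow> 0"
    using L1_limit_of_summable_steps[of M "\<lambda>k. f (r k)"] f by blast
  have "(\<lambda>n. \<integral>x. \<bar>f n x - g x\<bar> \<partial>M) \<longlonglongrightarrow> 0"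
  proof (rule LIMSEQ_I)
    fix e :: real assume e: "e > 0"
    have "(\<lambda>k. (1/2::real)^k) \<longlonglongrightarrow> 0" by (rule LIMSEQ_realpow_zero) auto
    then have "\<forall>\<^sub>F k in sequentially. (1/2::real)^k < e/2"
      using e by (intro order_tendstoD) auto
    moreover have "\<forall>\<^sub>F k in sequentially. (\<integral>x. \<bar>f (r k) x - g x\<bar> \<partial>M) < e/2"
      using e g(2) by (intro order_tendstoD) auto
    ultimately have "\<exists>k. (1/2::real)^k < e/2 \<and> (\<integral>x. \<bar>f (r k) x - g x\<bar> \<partial>M) < e/2"
      using eventually_happens'[OF sequentially_bot eventually_conj] by blast
    then obtain k where k: "(1/2::real)^k < e/2" "(\<integral>x. \<bar>f (r k) x - g x\<bar> \<partial>M) < e/2" by blast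
    have "(\<integral>x. \<bar>f n x - g x\<bar> \<partial>M) < e" if "n \<ge> N k" for n
      using L1_triangle[OF f g(1) f, of n "r k"] L1_triangle[OF f f g(1), of n "r k"]
        N[OF that r_ge] k by simp
    then show "\<exists>no. \<forall>n\<ge>no. norm ((\<integral>x. \<bar>f n x - g x\<bar> \<partial>M) - 0) < e" by auto
  qed
  with g(1) show ?thesis by blast
qed

text \<open>The form in which Cauchy estimates arise below: two approximate solutions are compared
  through bounds \<open>a m\<close> and \<open>a n\<close> for the errors of their data.\<close>

lemma L1_limit_of_null_bound:
  fixes f :: "nat \<Rightarrow> 'a \<Rightarrow> real"
  assumes f: "\<And>n. integrable M (f n)"
    and bound: "\<And>m n. (\<integral>x. \<bar>f m x - f n x\<bar> \<partial>M) \<le> a m + a n" and a: "a \<longlonglongrightarrow> (0::real)"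
  shows "\<exists>g. integrable M g \<and> (\<lambda>n. \<integral>x. \<bar>f n x - g x\<bar> \<partial>M) \<longlonglongrightarrow> 0"
proof (rule L1_complete[OF f])
  fix e :: real assume "e > 0"
  then have "\<forall>\<^sub>F n in sequentially. a n < e / 2" by (intro order_tendstoD[OF a]) auto
  then obtain N where N: "\<And>n. n \<ge> N \<Longrightarrow> a n < e / 2" by (auto simp: eventually_sequentially)
  have "(\<integral>x. \<bar>f m x - f n x\<bar> \<partial>M) < e" if "m \<ge> N" "n \<ge> N" for m n
    using bound[of m n] N[OF that(1)] N[OF that(2)] by linarith
  then show "\<exists>N. \<forall>m\<ge>N. \<forall>n\<ge>N. (\<integral>x. \<bar>f m x - f n x\<bar> \<partial>M) < e" by blast
qed

section \<open>Subgradients of finite convex functions\<close>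

text \<open>Real-valued counterpart of \<open>subgradient\<close>, which keeps the convex analysis
  free of extended-real arithmetic; \<open>subgradient_eq_subdiff\<close> identifies the two for
  finite nonnegative integrands.\<close>

definition subdiff :: "(real \<Rightarrow> real) \<Rightarrow> real \<Rightarrow> real set" where
  "subdiff q v = {u. \<forall>w. u * (w - v) \<le> q w - q v}"

lemma subdiff_mono:
  assumes "u \<in> subdiff q v" "u' \<in> subdiff q v'"
  shows "(u - u') * (v - v') \<ge> 0"
proof -
  have "u * (v' - v) \<le> q v' - q v" "u' * (v - v') \<le> q v - q v'"
    using assms by (auto simp: subdiff_def)
  then have "u * (v' - v) + u' * (v - v') \<le> 0" by linarith
  then show ?thesis by (simp add: algebra_simps)
qed

text \<open>For a fixed competitor \<open>w\<close> both sides of the subgradient inequality depend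
  continuously on slope and base point, so the inequality survives the limit.\<close>

lemma subdiff_closed:
  assumes q: "continuous_on UNIV q"
    and u: "\<And>n. u n \<in> subdiff q (v n)" "u \<longlonglongrightarrow> u0" "v \<longlonglongrightarrow> v0"
  shows "u0 \<in> subdiff q v0"
  unfolding subdiff_def
proof safe
  fix w
  have "(\<lambda>n. q (v n)) \<longlonglongrightarrow> q v0"
    using continuous_on_tendsto_compose[OF q u(3)] by simp
  then have 1: "(\<lambda>n. q w - q (v n)) \<longlonglongrightarrow> q w - q v0" by (intro tendsto_intros)
  have 2: "(\<lambda>n. u n * (w - v n)) \<longlonglongrightarrow> u0 * (w - v0)" by (intro tendsto_intros u)
  show "u0 * (w - v0) \<le> q w - q v0"
    by (rule LIMSEQ_le[OF 2 1]) (use u(1) in \<open>auto simp: subdiff_def\<close>)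
qed

text \<open>The minimiser of \<open>q y + (y - s)\<^sup>2 / (2 l)\<close> is sought between \<open>s - \<bar>s\<bar>\<close> and \<open>s + \<bar>s\<bar>\<close>; outside
  this interval the quadratic term alone exceeds the value at \<open>0\<close>.\<close>

lemma subdiff_resolvent_ex:
  assumes cvx: "convex_on UNIV q" and nn: "\<And>y. q y \<ge> 0" and q0: "q 0 = 0" and l: "l > 0"
  shows "\<exists>y. (s - y) / l \<in> subdiff q y"
proof -
  have cont: "continuous_on UNIV q" using convex_on_continuous[OF open_UNIV cvx] .
  define F where "F = (\<lambda>y. q y + (y - s)\<^sup>2 / (2 * l))"
  have "\<exists>y\<in>{s - \<bar>s\<bar>..s + \<bar>s\<bar>}. \<forall>z\<in>{s - \<bar>s\<bar>..s + \<bar>s\<bar>}. F y \<le> F z"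
    unfolding F_def using l
    by (intro continuous_attains_inf continuous_intros continuous_on_subset[OF cont]) auto
  then obtain y where y: "\<And>z. z \<in> {s - \<bar>s\<bar>..s + \<bar>s\<bar>} \<Longrightarrow> F y \<le> F z" by blast
  have F0: "F y \<le> s\<^sup>2 / (2 * l)" using y[of 0] abs_ge_self[of s] abs_ge_minus_self[of s] by (simp add: F_def q0)
  have min: "F y \<le> F z" for z
  proof (cases "z \<in> {s - \<bar>s\<bar>..s + \<bar>s\<bar>}")
    case False
    then have "\<bar>s\<bar> \<le> \<bar>z - s\<bar>" by auto
    then have "s\<^sup>2 \<le> (z - s)\<^sup>2" by (simp add: abs_le_square_iff)
    then have "s\<^sup>2 / (2 * l) \<le> (z - s)\<^sup>2 / (2 * l)" using l by (simp add: divide_right_mono)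
    then show ?thesis using F0 nn[of z] unfolding F_def by linarith
  qed (rule y)
  have "(s - y) / l * (w - y) \<le> q w - q y" for w
  proof -
    \<comment> \<open>Minimality of \<open>y\<close> is tested along the segment towards
      \<open>w\<close>. Convexity bounds the change of \<open>q\<close> linearly in
      \<open>t\<close>, and division by \<open>t\<close> leaves a remainder of order
      \<open>t\<close>.\<close>
    have *: "(s - y) / l * (w - y) \<le> q w - q y + t * ((w - y)\<^sup>2 / (2 * l))" if t: "t > 0" "t < 1" for t
    proof -
      have "q ((1 - t) *\<^sub>R y + t *\<^sub>R w) \<le> (1 - t) * q y + t * q w"
        by (rule convex_onD[OF cvx]) (use t in auto)
      then have a: "q (y + t * (w - y)) \<le> q y + t * (q w - q y)" by (simp add: algebra_simps)
      have "q y + (y - s)\<^sup>2 / (2 * l) \<le> q (y + t * (w - y)) + (y + t * (w - y) - s)\<^sup>2 / (2 * l)"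
        using min[of "y + t * (w - y)"] unfolding F_def .
      also have "\<dots> \<le> q y + t * (q w - q y) + (y + t * (w - y) - s)\<^sup>2 / (2 * l)"
        using a by simp
      also have "(y + t * (w - y) - s)\<^sup>2 / (2 * l)
          = (y - s)\<^sup>2 / (2 * l) - t * ((s - y) / l * (w - y)) + t * (t * ((w - y)\<^sup>2 / (2 * l)))"
        using l by (simp add: field_simps power2_eq_square)
      finally have "t * ((s - y) / l * (w - y)) \<le> t * (q w - q y + t * ((w - y)\<^sup>2 / (2 * l)))"
        by (simp add: algebra_simps)
      then show ?thesis using t(1) by (simp only: mult_le_cancel_left_pos)
    qed
    have "((\<lambda>t. q w - q y + t * ((w - y)\<^sup>2 / (2 * l))) \<longlongrightarrow> q w - q y + 0 * ((w - y)\<^sup>2 / (2 * l))) (at_right 0)"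
      by (intro tendsto_intros)
    then have "((\<lambda>t. q w - q y + t * ((w - y)\<^sup>2 / (2 * l))) \<longlongrightarrow> q w - q y) (at_right 0)"
      by simp
    then show ?thesis
      by (rule tendsto_lowerbound) (use * in \<open>auto simp: eventually_at_right_field intro!: exI[of _ 1]\<close>)
  qed
  then show ?thesis unfolding subdiff_def by auto
qed

section \<open>Proximal maps: nonexpansiveness and measurability\<close>

text \<open>The resolvent of \<open>subdiff q\<close> with parameter \<open>l\<close>; the quotient
  \<open>(s - prox l q s) / l\<close> is the Yosida approximation at \<open>s\<close>. Existence is
  \<open>subdiff_resolvent_ex\<close>, and monotonicity of the subdifferential makes the chosen
  point unique.\<close>

definition prox :: "real \<Rightarrow> (real \<Rightarrow> real) \<Rightarrow> real \<Rightarrow> real" where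
  "prox l q s = (SOME y. (s - y) / l \<in> subdiff q y)"

context
  fixes q :: "real \<Rightarrow> real" and l :: real
  assumes cvx: "convex_on UNIV q" and nn: "\<And>y. q y \<ge> 0" and q0: "q 0 = 0" and l: "l > 0"
begin

lemma prox_subdiff: "(s - prox l q s) / l \<in> subdiff q (prox l q s)"
  unfolding prox_def by (rule someI_ex) (rule subdiff_resolvent_ex[OF cvx nn q0 l])

text \<open>Monotonicity of \<open>subdiff q\<close> at the two proximal points gives
  \<open>(y - z)\<^sup>2 \<le> (s - t) * (y - z)\<close>, and a factor
  \<open>\<bar>y - z\<bar>\<close> cancels.\<close>

lemma prox_nonexpansive: "\<bar>prox l q s - prox l q t\<bar> \<le> \<bar>s - t\<bar>"
proof -
  define y z where "y = prox l q s" and "z = prox l q t"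
  have "((s - y) / l - (t - z) / l) * (y - z) \<ge> 0"
    using subdiff_mono[OF prox_subdiff prox_subdiff] unfolding y_def z_def .
  moreover have "((s - y) / l - (t - z) / l) * (y - z) = (s - t - (y - z)) * (y - z) / l"
    using l by (simp add: field_simps)
  ultimately have "(s - t - (y - z)) * (y - z) \<ge> 0"
    using l by (simp add: zero_le_divide_iff)
  then have "(y - z)\<^sup>2 \<le> (s - t) * (y - z)" by (simp add: algebra_simps power2_eq_square)
  also have "\<dots> \<le> \<bar>s - t\<bar> * \<bar>y - z\<bar>" by (metis abs_ge_self abs_mult)
  finally have "\<bar>y - z\<bar> * \<bar>y - z\<bar> \<le> \<bar>s - t\<bar> * \<bar>y - z\<bar>" by (simp add: power2_eq_square)
  then have "\<bar>y - z\<bar> \<le> \<bar>s - t\<bar>"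
    by (metis abs_ge_zero abs_zero le_less mult_le_cancel_right_pos)
  then show ?thesis unfolding y_def z_def .
qed

lemma prox_zero: "prox l q 0 = 0"
proof -
  have "0 \<in> subdiff q 0" using nn q0 by (auto simp: subdiff_def)
  from subdiff_mono[OF prox_subdiff[of 0] this] have "prox l q 0 * prox l q 0 \<le> 0"
    using l by (simp add: field_simps)
  then show ?thesis by (metis mult_eq_0_iff zero_le_square order_antisym)
qed

lemma prox_abs_le: "\<bar>prox l q s\<bar> \<le> \<bar>s\<bar>"
  using prox_nonexpansive[of s 0] by (simp add: prox_zero)

text \<open>\<open>y \<le> r\<close> for the solution of \<open>s \<in> y + l \<partial>q(y)\<close> means that \<open>(s - r) / l\<close> is at most the right
  derivative of \<open>q\<close> at \<open>r\<close>. This condition involves countably many values of \<open>q\<close> only.\<close>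

lemma prox_le_iff:
  "prox l q s \<le> r \<longleftrightarrow> (\<forall>n. (s - r) / l * (1 / real (Suc n)) \<le> q (r + 1 / real (Suc n)) - q r)"
    (is "?L \<longleftrightarrow> ?R")
proof
  define y where "y = prox l q s"
  have y: "(s - y) / l * (w - y) \<le> q w - q y" for w
    using prox_subdiff[of s] unfolding y_def subdiff_def by auto
  {
    assume ?L
    then have yr: "y \<le> r" unfolding y_def .
    show ?R
    proof
      fix n
      define h where "h = 1 / real (Suc n)"
      have h: "h > 0" unfolding h_def by simp
      \<comment> \<open>By convexity the slope of \<open>q\<close> over \<open>[r, r + h]\<close> is
        at least its slope over \<open>[y, r]\<close>, hence at least the subgradient at
        \<open>y\<close>. For \<open>y = r\<close> the subgradient inequality suffices.\<close>
      have slope: "(s - y) / l * h \<le> q (r + h) - q r"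
      proof (cases "y = r")
        case True
        then show ?thesis using y[of "r + h"] by simp
      next
        case False
        with yr have yr: "y < r" by simp
        define k where "k = r - y"
        have k: "k > 0" using yr unfolding k_def by simp
        have convex_comb: "(1 - a) *\<^sub>R y + a *\<^sub>R (r + h) = y + a * (k + h)" for a
          unfolding k_def by (simp add: algebra_simps)
        have "(1 - k / (k + h)) *\<^sub>R y + (k / (k + h)) *\<^sub>R (r + h) = y + k / (k + h) * (k + h)"
          by (rule convex_comb)
        also have "\<dots> = r" using k h unfolding k_def by simp
        finally have "r = (1 - k / (k + h)) *\<^sub>R y + (k / (k + h)) *\<^sub>R (r + h)" by simp
        moreover have "q ((1 - k / (k + h)) *\<^sub>R y + (k / (k + h)) *\<^sub>R (r + h))
            \<le> (1 - k / (k + h)) * q y + (k / (k + h)) * q (r + h)"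
          by (rule convex_onD[OF cvx]) (use k h in auto)
        ultimately have "q r \<le> (1 - k / (k + h)) * q y + (k / (k + h)) * q (r + h)" by simp
        moreover have "1 - k / (k + h) = h / (k + h)" using k h by (simp add: field_simps)
        ultimately have "q r \<le> (h * q y + k * q (r + h)) / (k + h)" by (simp add: add_divide_distrib)
        then have "(k + h) * q r \<le> h * q y + k * q (r + h)"
          using k h by (simp add: pos_le_divide_eq mult.commute)
        then have *: "h * (q r - q y) \<le> k * (q (r + h) - q r)" by (simp add: algebra_simps)
        have "(s - y) / l * k \<le> q r - q y" using y[of r] unfolding k_def .
        then have "h * ((s - y) / l * k) \<le> h * (q r - q y)" using h by (intro mult_left_mono) simp_all
        with * have "k * ((s - y) / l * h) \<le> k * (q (r + h) - q r)"
          by (simp add: algebra_simps)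
        then show ?thesis using k by (simp only: mult_le_cancel_left_pos)
      qed
      have "(s - r) / l \<le> (s - y) / l" using yr l by (simp add: divide_right_mono)
      then have "(s - r) / l * h \<le> (s - y) / l * h" using h by (intro mult_right_mono) simp_all
      with slope show "(s - r) / l * (1 / real (Suc n)) \<le> q (r + 1 / real (Suc n)) - q r"
        unfolding h_def by simp
    qed
  }
  {
    assume R: ?R
    show ?L
    proof (rule ccontr)
      assume "\<not> ?L"
      then have yr: "r < y" unfolding y_def by simp
      \<comment> \<open>With \<open>r + h\<close> strictly between \<open>r\<close> and
        \<open>y\<close>, convexity bounds the slope over \<open>[r, r + h]\<close> by the slope
        over \<open>[r, y]\<close>, hence by \<open>(s - y) / l\<close>, which is smaller than
        \<open>(s - r) / l\<close>.\<close>
      then obtain n where n: "1 / real (Suc n) < y - r"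
        using nat_approx_posE[of "y - r"] by auto
      define h where "h = 1 / real (Suc n)"
      define k where "k = y - r"
      have h: "h > 0" "h < k" using n unfolding h_def k_def by auto
      have convex_comb: "(1 - a) *\<^sub>R r + a *\<^sub>R y = r + a * k" for a
        unfolding k_def by (simp add: algebra_simps)
      have "(1 - h / k) *\<^sub>R r + (h / k) *\<^sub>R y = r + h / k * k" by (rule convex_comb)
      also have "\<dots> = r + h" using h by simp
      finally have "r + h = (1 - h / k) *\<^sub>R r + (h / k) *\<^sub>R y" by simp
      moreover have "q ((1 - h / k) *\<^sub>R r + (h / k) *\<^sub>R y) \<le> (1 - h / k) * q r + (h / k) * q y"
        by (rule convex_onD[OF cvx]) (use h in auto)
      ultimately have "q (r + h) \<le> (1 - h / k) * q r + (h / k) * q y" by simp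
      then have 1: "k * (q (r + h) - q r) \<le> h * (q y - q r)"
        using h by (simp add: field_simps)
      have 2: "(s - r) / l * h \<le> q (r + h) - q r" using R unfolding h_def by simp
      have "(s - y) / l * (r - y) = - ((s - y) / l * k)"
        unfolding k_def by (metis minus_diff_eq mult_minus_right)
      then have "q y - q r \<le> (s - y) / l * k" using y[of r] by linarith
      then have "h * (q y - q r) \<le> h * ((s - y) / l * k)" using h by (intro mult_left_mono) simp_all
      moreover have "k * ((s - r) / l * h) \<le> k * (q (r + h) - q r)" using 2 h by (intro mult_left_mono) simp_all
      ultimately have "(h * k) * ((s - r) / l) \<le> (h * k) * ((s - y) / l)"
        using 1 by (simp add: algebra_simps)
      then have "(s - r) / l \<le> (s - y) / l"
        using h by (simp only: mult_le_cancel_left_pos mult_pos_pos order.strict_trans[OF h])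
      then show False using yr l by (simp add: divide_le_cancel)
    qed
  }
qed

end

text \<open>By \<open>prox_le_iff\<close> each sublevel set is a countable intersection of
  measurable sets; this takes the place of a measurable selection argument.\<close>

lemma prox_measurable:
  assumes p: "\<And>x. x \<in> space M \<Longrightarrow> convex_on UNIV (p x)" "\<And>x y. x \<in> space M \<Longrightarrow> p x y \<ge> 0"
    "\<And>x. x \<in> space M \<Longrightarrow> p x 0 = 0" "\<And>s. (\<lambda>x. p x s) \<in> borel_measurable M"
    and l: "l > 0" and [measurable]: "v \<in> borel_measurable M"
  shows "(\<lambda>x. prox l (p x) (v x)) \<in> borel_measurable M"
proof (subst borel_measurable_iff_le, rule allI)
  fix r
  note p(4)[measurable]
  have "{x \<in> space M. prox l (p x) (v x) \<le> r}
      = {x \<in> space M. \<forall>n. (v x - r) / l * (1 / real (Suc n)) \<le> p x (r + 1 / real (Suc n)) - p x r}"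
    using prox_le_iff[OF p(1-3) l] by auto
  also have "\<dots> \<in> sets M" by measurable
  finally show "{x \<in> space M. prox l (p x) (v x) \<le> r} \<in> sets M" .
qed

section \<open>Accretive operators in \<open>L\<^sup>1\<close> with the sub-Markov property\<close>

text \<open>A discrete layer-cake formula: counting the levels \<open>k * h\<close> below
  \<open>s\<close> rounds \<open>max s 0\<close> up to a multiple of \<open>h\<close>. The saturated
  case \<open>s > real m * h\<close> is carried along because the induction step uses it.\<close>

lemma Riemann_sum_indicators:
  fixes s h :: real
  assumes h: "h > 0"
  shows "(s \<le> real m * h \<longrightarrow> max s 0 \<le> (\<Sum>k<m. if real k * h < s then h else 0) \<and>
            (\<Sum>k<m. if real k * h < s then h else 0) \<le> max s 0 + h) \<and>
         (s > real m * h \<longrightarrow> (\<Sum>k<m. if real k * h < s then h else 0) = real m * h)"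
proof (induction m)
  case (Suc m)
  have "real (Suc m) * h = real m * h + h" by (simp add: algebra_simps)
  moreover have "real m * h \<ge> 0" using h by simp
  ultimately show ?case using Suc h by (cases "s \<le> real m * h") (auto simp: not_le)
qed (use h in auto)

lemma AE_eq_integral_abs:
  fixes f g :: "'a \<Rightarrow> real"
  assumes "integrable M f" "integrable M g" "AE x in M. f x = g x"
  shows "(\<integral>x. \<bar>f x\<bar> \<partial>M) = (\<integral>x. \<bar>g x\<bar> \<partial>M)"
  by (rule integral_cong_AE) (use assms in auto)

lemma integrable_mult_bounded:
  fixes f g :: "'a \<Rightarrow> real"
  assumes f: "integrable M f" and [measurable]: "g \<in> borel_measurable M"
    and g: "AE x in M. \<bar>g x\<bar> \<le> B"
  shows "integrable M (\<lambda>x. f x * g x)"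
proof (rule Bochner_Integration.integrable_bound)
  show "integrable M (\<lambda>x. B * f x)" using f by simp
  show "(\<lambda>x. f x * g x) \<in> borel_measurable M" using f by measurable
  show "AE x in M. norm (f x * g x) \<le> norm (B * f x)"
    using g
  proof eventually_elim
    case (elim x)
    then have "\<bar>g x\<bar> \<le> \<bar>B\<bar>" by simp
    from mult_left_mono[OF this abs_ge_zero[of "f x"]] show ?case
      by (simp add: abs_mult mult.commute)
  qed
qed

lemma integral_abs_eq_parts:
  fixes f :: "'a \<Rightarrow> real"
  assumes "integrable M f"
  shows "(\<integral>x. \<bar>f x\<bar> \<partial>M) = (\<integral>x. max (f x) 0 \<partial>M) + (\<integral>x. max (- f x) 0 \<partial>M)"
proof -
  have "(\<integral>x. \<bar>f x\<bar> \<partial>M) = (\<integral>x. max (f x) 0 + max (- f x) 0 \<partial>M)"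
    by (rule Bochner_Integration.integral_cong) auto
  also have "\<dots> = (\<integral>x. max (f x) 0 \<partial>M) + (\<integral>x. max (- f x) 0 \<partial>M)"
    by (rule Bochner_Integration.integral_add) (use assms in auto)
  finally show ?thesis .
qed

text \<open>The case \<open>\<lambda> > \<mu> > 0\<close>, \<open>\<langle>a - b, \<lambda> a - \<mu> b\<rangle> \<le> 0\<close> of Tikhonov regularisation: it forces
  \<open>\<parallel>a\<parallel>\<^sup>2 \<le> \<langle>a, b\<rangle>\<close>. Norms that increase and stay bounded then give strong convergence, so that no
  weak compactness is needed.\<close>

lemma L2_difference_le:
  fixes a b :: "'a \<Rightarrow> real"
  assumes sq: "integrable M (\<lambda>x. (a x)\<^sup>2)" "integrable M (\<lambda>x. (b x)\<^sup>2)" "integrable M (\<lambda>x. a x * b x)"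
    and lm: "l > m" and m: "m > 0"
    and obtuse: "(\<integral>x. (a x - b x) * (l * a x - m * b x) \<partial>M) \<le> 0"
  shows "(\<integral>x. (a x - b x)\<^sup>2 \<partial>M) \<le> (\<integral>x. (b x)\<^sup>2 \<partial>M) - (\<integral>x. (a x)\<^sup>2 \<partial>M)"
proof -
  define X Z P where "X = (\<integral>x. (a x)\<^sup>2 \<partial>M)" and "Z = (\<integral>x. (b x)\<^sup>2 \<partial>M)" and "P = (\<integral>x. a x * b x \<partial>M)"
  have "(\<integral>x. (a x - b x)\<^sup>2 \<partial>M) = (\<integral>x. (a x)\<^sup>2 - 2 * (a x * b x) + (b x)\<^sup>2 \<partial>M)"
    by (rule Bochner_Integration.integral_cong) (auto simp: power2_eq_square algebra_simps)
  also have "\<dots> = X - 2 * P + Z" unfolding X_def Z_def P_def using sq by simp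
  finally have diff: "(\<integral>x. (a x - b x)\<^sup>2 \<partial>M) = X - 2 * P + Z" .
  moreover have "(\<integral>x. (a x - b x)\<^sup>2 \<partial>M) \<ge> 0" by simp
  ultimately have nn: "P - Z \<le> X - P" by simp
  have "(\<integral>x. (a x - b x) * (l * a x - m * b x) \<partial>M)
      = (\<integral>x. l * (a x)\<^sup>2 - (l + m) * (a x * b x) + m * (b x)\<^sup>2 \<partial>M)"
    by (rule Bochner_Integration.integral_cong) (auto simp: power2_eq_square algebra_simps)
  also have "\<dots> = l * X - (l + m) * P + m * Z" unfolding X_def Z_def P_def using sq by simp
  finally have "l * (X - P) \<le> m * (P - Z)" using obtuse by (simp add: algebra_simps)
  also have "\<dots> \<le> m * (X - P)" using nn m by simp
  finally have "(l - m) * (X - P) \<le> 0" by (simp add: algebra_simps)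
  then have "X \<le> P" using lm by (simp add: mult_le_0_iff)
  then show ?thesis unfolding diff X_def[symmetric] Z_def[symmetric] by simp
qed

text \<open>The operator is described on an arbitrary finite measure space through representatives.
  By linearity the contraction property becomes the estimate \<open>accretive\<close> for one
  element, and the bound on essential suprema becomes \<open>submarkov\<close>, phrased with
  constants \<open>t \<ge> 0\<close>.\<close>

locale L1_operator = finite_measure M for M :: "'a measure" +
  fixes D :: "('a \<Rightarrow> real) set" and A :: "('a \<Rightarrow> real) \<Rightarrow> 'a \<Rightarrow> real" and c :: real
  assumes D_integrable: "v \<in> D \<Longrightarrow> integrable M v"
    and A_integrable: "v \<in> D \<Longrightarrow> integrable M (A v)"
    and D_cong: "v \<in> D \<Longrightarrow> integrable M w \<Longrightarrow> AE x in M. v x = w x \<Longrightarrow> w \<in> D"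
    and A_cong: "v \<in> D \<Longrightarrow> integrable M w \<Longrightarrow> AE x in M. v x = w x \<Longrightarrow> AE x in M. A v x = A w x"
    and D_lin: "v \<in> D \<Longrightarrow> w \<in> D \<Longrightarrow> (\<lambda>x. a * v x + b * w x) \<in> D"
    and A_lin: "v \<in> D \<Longrightarrow> w \<in> D \<Longrightarrow>
      AE x in M. A (\<lambda>x. a * v x + b * w x) x = a * A v x + b * A w x"
    and dense: "integrable M f \<Longrightarrow> e > 0 \<Longrightarrow> \<exists>v\<in>D. (\<integral>x. \<bar>f x - v x\<bar> \<partial>M) < e"
    and range: "integrable M f \<Longrightarrow> r > 0 \<Longrightarrow> \<exists>v\<in>D. AE x in M. v x + r * A v x = f x"
    and accretive: "v \<in> D \<Longrightarrow> r > 0 \<Longrightarrow> (\<integral>x. \<bar>v x\<bar> \<partial>M) \<le> (\<integral>x. \<bar>v x + r * A v x\<bar> \<partial>M)"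
    and submarkov: "v \<in> D \<Longrightarrow> r > 0 \<Longrightarrow> t \<ge> 0 \<Longrightarrow>
      AE x in M. v x + r * A v x \<le> t \<Longrightarrow> AE x in M. v x \<le> t"
    and c_pos: "c > 0"
    and coercive: "v \<in> D \<Longrightarrow> c * (\<integral>x. \<bar>v x\<bar> \<partial>M) \<le> (\<integral>x. \<bar>A v x\<bar> \<partial>M)"
begin

section \<open>Elementary rules for the operator and closedness of its graph\<close>

lemma D_measurable: "v \<in> D \<Longrightarrow> v \<in> borel_measurable M"
  by (intro borel_measurable_integrable D_integrable)

lemma A_measurable: "v \<in> D \<Longrightarrow> A v \<in> borel_measurable M"
  by (intro borel_measurable_integrable A_integrable)

lemmas D_simps = D_integrable A_integrable D_measurable A_measurable

lemma zero_D: "(\<lambda>x. 0) \<in> D" and A_zero: "AE x in M. A (\<lambda>x. 0) x = 0"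
proof -
  obtain v where v: "v \<in> D" using dense[of "\<lambda>x. 0" 1] by auto
  show "(\<lambda>x. 0) \<in> D" using D_lin[OF v v, of 0 0] by simp
  show "AE x in M. A (\<lambda>x. 0) x = 0" using A_lin[OF v v, of 0 0] by simp
qed

lemma diff_D: "v \<in> D \<Longrightarrow> w \<in> D \<Longrightarrow> (\<lambda>x. v x - w x) \<in> D"
  using D_lin[of v w 1 "-1"] by simp

lemma A_diff: "v \<in> D \<Longrightarrow> w \<in> D \<Longrightarrow> AE x in M. A (\<lambda>x. v x - w x) x = A v x - A w x"
  using A_lin[of v w 1 "-1"] by simp

lemma minus_D: "v \<in> D \<Longrightarrow> (\<lambda>x. - v x) \<in> D"
  using D_lin[of v v 0 "-1"] by simp

lemma A_minus: "v \<in> D \<Longrightarrow> AE x in M. A (\<lambda>x. - v x) x = - A v x"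
  using A_lin[of v v 0 "-1"] by simp

lemma accretive_diff:
  assumes v: "v \<in> D" "w \<in> D" and r: "r > 0"
  shows "(\<integral>x. \<bar>v x - w x\<bar> \<partial>M) \<le> (\<integral>x. \<bar>(v x + r * A v x) - (w x + r * A w x)\<bar> \<partial>M)"
proof -
  have "(\<integral>x. \<bar>v x - w x\<bar> \<partial>M) \<le> (\<integral>x. \<bar>(v x - w x) + r * A (\<lambda>x. v x - w x) x\<bar> \<partial>M)"
    by (rule accretive[OF diff_D[OF v] r])
  also have "\<dots> = (\<integral>x. \<bar>(v x + r * A v x) - (w x + r * A w x)\<bar> \<partial>M)"
  proof (rule AE_eq_integral_abs)
    show "AE x in M. (v x - w x) + r * A (\<lambda>x. v x - w x) x = (v x + r * A v x) - (w x + r * A w x)"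
      using A_diff[OF v] by eventually_elim (simp add: right_diff_distrib)
  qed (use v D_simps diff_D[OF v] in auto)
  finally show ?thesis .
qed

lemma coercive_diff:
  assumes v: "v \<in> D" "w \<in> D"
  shows "c * (\<integral>x. \<bar>v x - w x\<bar> \<partial>M) \<le> (\<integral>x. \<bar>A v x - A w x\<bar> \<partial>M)"
proof -
  have "c * (\<integral>x. \<bar>v x - w x\<bar> \<partial>M) \<le> (\<integral>x. \<bar>A (\<lambda>x. v x - w x) x\<bar> \<partial>M)"
    by (rule coercive[OF diff_D[OF v]])
  also have "\<dots> = (\<integral>x. \<bar>A v x - A w x\<bar> \<partial>M)"
    by (rule AE_eq_integral_abs) (use v D_simps diff_D[OF v] A_diff[OF v] in auto)
  finally show ?thesis .
qed

text \<open>The solution \<open>z\<close> of \<open>z + A z = v0 + h\<close> is a second limit of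
  \<open>v n\<close>, because accretivity bounds the distance from \<open>v n\<close> to
  \<open>z\<close> by the two errors that tend to zero. Hence \<open>z\<close> and \<open>v0\<close>
  agree.\<close>

lemma closed:
  assumes v: "\<And>n. v n \<in> D" and v0: "integrable M v0" and h: "integrable M h"
    and lim: "(\<lambda>n. \<integral>x. \<bar>v n x - v0 x\<bar> \<partial>M) \<longlonglongrightarrow> 0" "(\<lambda>n. \<integral>x. \<bar>A (v n) x - h x\<bar> \<partial>M) \<longlonglongrightarrow> 0"
  shows "v0 \<in> D" "AE x in M. A v0 x = h x"
proof -
  obtain z where z: "z \<in> D" and eq: "AE x in M. z x + 1 * A z x = v0 x + h x"
    using range[of "\<lambda>x. v0 x + h x" 1] v0 h by auto
  have "(\<integral>x. \<bar>v0 x - z x\<bar> \<partial>M) \<le> 2 * (\<integral>x. \<bar>v n x - v0 x\<bar> \<partial>M) + (\<integral>x. \<bar>A (v n) x - h x\<bar> \<partial>M)" for n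
  proof -
    have "(\<integral>x. \<bar>v n x - z x\<bar> \<partial>M)
        \<le> (\<integral>x. \<bar>(v n x + 1 * A (v n) x) - (z x + 1 * A z x)\<bar> \<partial>M)"
      by (rule accretive_diff[OF v z]) simp
    also have "\<dots> = (\<integral>x. \<bar>(v n x - v0 x) + (A (v n) x - h x)\<bar> \<partial>M)"
    proof (rule AE_eq_integral_abs)
      show "AE x in M. (v n x + 1 * A (v n) x) - (z x + 1 * A z x) = (v n x - v0 x) + (A (v n) x - h x)"
        using eq by eventually_elim simp
    qed (use v z v0 h D_simps in auto)
    also have "\<dots> \<le> (\<integral>x. \<bar>v n x - v0 x\<bar> + \<bar>A (v n) x - h x\<bar> \<partial>M)"
      by (rule integral_mono) (use v v0 h D_simps in auto)
    also have "\<dots> = (\<integral>x. \<bar>v n x - v0 x\<bar> \<partial>M) + (\<integral>x. \<bar>A (v n) x - h x\<bar> \<partial>M)"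
      by (rule Bochner_Integration.integral_add) (use v v0 h D_simps in auto)
    finally show ?thesis
      using L1_triangle[OF v0 D_integrable[OF v] D_integrable[OF z], of n]
        L1_diff_commute[of M v0 "v n"] by linarith
  qed
  moreover have "(\<lambda>n. 2 * (\<integral>x. \<bar>v n x - v0 x\<bar> \<partial>M) + (\<integral>x. \<bar>A (v n) x - h x\<bar> \<partial>M)) \<longlonglongrightarrow> 2 * 0 + 0"
    by (intro tendsto_intros lim)
  ultimately have "(\<integral>x. \<bar>v0 x - z x\<bar> \<partial>M) \<le> 0"
    by (intro LIMSEQ_le_const[of _ 0]) auto
  then have v0z: "AE x in M. v0 x = z x"
    by (intro L1_zero_AE_eq) (use v0 z D_simps in auto)
  then have zv: "AE x in M. z x = v0 x" by eventually_elim simp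
  show "v0 \<in> D" by (rule D_cong[OF z v0 zv])
  show "AE x in M. A v0 x = h x"
    using zv A_cong[OF z v0 zv] eq by eventually_elim simp
qed

section \<open>Testing with sections of the Heaviside graph\<close>

text \<open>Let \<open>q\<close> be the resolvent of the excess \<open>max (v x - t) 0\<close>. The
  sub-Markov property gives \<open>q \<ge> 0\<close> and \<open>z - t \<le> q\<close>. Since
  \<open>r * A z = v - z\<close>, the tested integral times \<open>r\<close> is at least the
  integral of the excess minus that of \<open>q\<close>, which is nonnegative by
  contraction.\<close>

lemma resolvent_test:
  assumes v: "v \<in> D" and z: "z \<in> D" and eq: "AE x in M. z x + r * A z x = v x"
    and r: "r > 0" and t: "t \<ge> 0" and [measurable]: "g \<in> borel_measurable M"
    and g: "AE x in M. 0 \<le> g x \<and> g x \<le> 1"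
    and g1: "AE x in M. v x > t \<longrightarrow> g x = 1" and g0: "AE x in M. v x < t \<longrightarrow> g x = 0"
  shows "(\<integral>x. A z x * g x \<partial>M) \<ge> 0"
proof -
  have g_bd: "AE x in M. \<bar>g x\<bar> \<le> 1" using g by eventually_elim auto
  have vt: "integrable M (\<lambda>x. max (v x - t) 0)" using v D_simps by auto
  obtain q where q: "q \<in> D" and q_eq: "AE x in M. q x + r * A q x = max (v x - t) 0"
    using range[OF vt r] by auto
  have "AE x in M. - q x \<le> 0"
  proof (rule submarkov[OF minus_D[OF q] r order.refl])
    show "AE x in M. - q x + r * A (\<lambda>x. - q x) x \<le> 0"
      using A_minus[OF q] q_eq by eventually_elim (auto simp: max_def split: if_splits)
  qed
  moreover have "AE x in M. z x - q x \<le> t"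
  proof (rule submarkov[OF diff_D[OF z q] r t])
    show "AE x in M. z x - q x + r * A (\<lambda>x. z x - q x) x \<le> t"
      using A_diff[OF z q] q_eq eq
    proof eventually_elim
      case (elim x)
      have "r * A (\<lambda>x. z x - q x) x = r * A z x - r * A q x"
        using elim(1) by (simp add: right_diff_distrib)
      then show ?case using elim(2,3) by simp
    qed
  qed
  ultimately have "AE x in M. max (v x - t) 0 - q x \<le> r * (A z x * g x)"
    using g g1 g0 eq
  proof eventually_elim
    case (elim x)
    have "(v x - t) * g x = max (v x - t) 0"
      using elim by (cases "v x" t rule: linorder_cases) auto
    moreover have "(z x - t) * g x \<le> q x * g x"
      using elim by (intro mult_right_mono) auto
    moreover have "q x * g x \<le> q x * 1"
      using elim by (intro mult_left_mono) auto
    moreover have "r * (A z x * g x) = (v x - t) * g x - (z x - t) * g x"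
    proof -
      have "r * A z x = v x - z x" using elim by simp
      then have "r * (A z x * g x) = (v x - z x) * g x" by (simp add: mult.assoc[symmetric])
      then show ?thesis by (simp add: algebra_simps)
    qed
    ultimately show ?case by linarith
  qed
  then have "(\<integral>x. max (v x - t) 0 - q x \<partial>M) \<le> (\<integral>x. r * (A z x * g x) \<partial>M)"
    using vt q z D_simps integrable_mult_bounded[OF A_integrable[OF z] _ g_bd]
    by (intro integral_mono_AE) auto
  moreover have "(\<integral>x. max (v x - t) 0 - q x \<partial>M) \<ge> 0"
  proof -
    have "(\<integral>x. q x \<partial>M) \<le> (\<integral>x. \<bar>q x\<bar> \<partial>M)"
      by (rule integral_mono) (use q D_simps in auto)
    also have "\<dots> \<le> (\<integral>x. \<bar>q x + r * A q x\<bar> \<partial>M)" by (rule accretive[OF q r])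
    also have "\<dots> = (\<integral>x. \<bar>max (v x - t) 0\<bar> \<partial>M)"
      by (rule AE_eq_integral_abs) (use q_eq q vt D_simps in auto)
    finally show ?thesis using vt q D_simps by simp
  qed
  ultimately have "0 \<le> r * (\<integral>x. A z x * g x \<partial>M)" by simp
  then show ?thesis using r by (simp add: zero_le_mult_iff)
qed

text \<open>The resolvents \<open>z\<close> of \<open>v\<close> satisfy \<open>A z = (I + r A)\<^sup>-\<^sup>1 (A v)\<close>, and comparing this function with
  an element \<open>d\<close> of the dense domain gives \<open>A z \<longrightarrow> A v\<close> as \<open>r \<longrightarrow> 0\<close>.\<close>

lemma indicator_test:
  assumes v: "v \<in> D" and t: "t \<ge> 0" and [measurable]: "g \<in> borel_measurable M"
    and g: "AE x in M. 0 \<le> g x \<and> g x \<le> 1"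
    and g1: "AE x in M. v x > t \<longrightarrow> g x = 1" and g0: "AE x in M. v x < t \<longrightarrow> g x = 0"
  shows "(\<integral>x. A v x * g x \<partial>M) \<ge> 0"
proof -
  have g_bd: "AE x in M. \<bar>g x\<bar> \<le> 1" using g by eventually_elim auto
  have "0 \<le> (\<integral>x. A v x * g x \<partial>M) + e" if e: "e > 0" for e
  proof -
    \<comment> \<open>The quarter is spent twice: once in comparing \<open>y\<close> with
      \<open>d\<close> and once in returning from \<open>d\<close> to \<open>A v\<close>.\<close>
    obtain d where d: "d \<in> D" "(\<integral>x. \<bar>A v x - d x\<bar> \<partial>M) < e / 4"
      using dense[OF A_integrable[OF v], of "e / 4"] e by auto
    define K where "K = 1 + (\<integral>x. \<bar>A d x\<bar> \<partial>M)"
    have K: "K \<ge> 1" unfolding K_def by simp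
    \<comment> \<open>Chosen so that \<open>r * K = e / 2\<close>; the summand 1 in \<open>K\<close>
      keeps the denominator positive.\<close>
    define r where "r = e / (2 * K)"
    have r: "r > 0" unfolding r_def using e K by simp
    obtain z where z: "z \<in> D" and eq: "AE x in M. z x + r * A z x = v x"
      using range[OF D_integrable[OF v] r] by auto
    \<comment> \<open>A representative of \<open>A z\<close> that visibly lies in \<open>D\<close>,
      so that \<open>A\<close> can be applied to it.\<close>
    define y where "y = (\<lambda>x. 1 / r * v x + (- 1 / r) * z x)"
    have y: "y \<in> D" unfolding y_def by (rule D_lin[OF v z])
    have y_eq: "AE x in M. y x = A z x"
      using eq
    proof eventually_elim
      case (elim x)
      then have "y x = (v x - z x) / r" unfolding y_def by (simp add: diff_divide_distrib)
      then show ?case using elim[symmetric] r by simp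
    qed
    have Ay: "AE x in M. y x + r * A y x = A v x"
      using A_lin[OF v z, of "1 / r" "- 1 / r"] y_eq
    proof eventually_elim
      case (elim x)
      then have "A y x = (A v x - A z x) / r" unfolding y_def by (simp add: diff_divide_distrib)
      then show ?case using elim r by simp
    qed
    have "(\<integral>x. \<bar>y x - d x\<bar> \<partial>M) \<le> (\<integral>x. \<bar>(y x + r * A y x) - (d x + r * A d x)\<bar> \<partial>M)"
      by (rule accretive_diff[OF y d(1) r])
    also have "\<dots> = (\<integral>x. \<bar>A v x - (d x + r * A d x)\<bar> \<partial>M)"
      by (rule AE_eq_integral_abs) (use Ay y v d D_simps in auto)
    also have "\<dots> \<le> (\<integral>x. \<bar>A v x - d x\<bar> + r * \<bar>A d x\<bar> \<partial>M)"
    proof (rule integral_mono)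
      show "\<bar>A v x - (d x + r * A d x)\<bar> \<le> \<bar>A v x - d x\<bar> + r * \<bar>A d x\<bar>" for x
        using abs_triangle_ineq4[of "A v x - d x" "r * A d x"] r by (simp add: abs_mult algebra_simps)
    qed (use v d D_simps in auto)
    also have "\<dots> = (\<integral>x. \<bar>A v x - d x\<bar> \<partial>M) + r * (\<integral>x. \<bar>A d x\<bar> \<partial>M)"
      by (subst Bochner_Integration.integral_add) (use v d D_simps in auto)
    also have "r * (\<integral>x. \<bar>A d x\<bar> \<partial>M) \<le> r * K"
      using r unfolding K_def by (intro mult_left_mono) auto
    also have "r * K = e / 2" unfolding r_def using K by simp
    finally have yd: "(\<integral>x. \<bar>y x - d x\<bar> \<partial>M) \<le> (\<integral>x. \<bar>A v x - d x\<bar> \<partial>M) + e / 2" by simp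
    have "(\<integral>x. \<bar>y x - A v x\<bar> \<partial>M) \<le> (\<integral>x. \<bar>y x - d x\<bar> \<partial>M) + (\<integral>x. \<bar>d x - A v x\<bar> \<partial>M)"
      by (rule L1_triangle) (use y v d D_simps in auto)
    then have yAv: "(\<integral>x. \<bar>y x - A v x\<bar> \<partial>M) \<le> e"
      using yd d(2) L1_diff_commute[of M d "A v"] by linarith
    have int: "integrable M (\<lambda>x. A z x * g x)" "integrable M (\<lambda>x. A v x * g x)"
      using v z by (auto intro!: integrable_mult_bounded[OF _ _ g_bd] A_integrable)
    have "0 \<le> (\<integral>x. A z x * g x \<partial>M)"
      by (rule resolvent_test[OF v z eq r t _ g g1 g0]) measurable
    also have "\<dots> \<le> (\<integral>x. A v x * g x + \<bar>y x - A v x\<bar> \<partial>M)"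
    proof (rule integral_mono_AE)
      show "AE x in M. A z x * g x \<le> A v x * g x + \<bar>y x - A v x\<bar>"
        using y_eq g
      proof eventually_elim
        case (elim x)
        have "(y x - A v x) * g x \<le> \<bar>y x - A v x\<bar> * g x"
          using elim by (intro mult_right_mono) auto
        also have "\<dots> \<le> \<bar>y x - A v x\<bar> * 1"
          using elim by (intro mult_left_mono) auto
        finally show ?case using elim by (simp add: algebra_simps)
      qed
    qed (use y v int D_simps in auto)
    also have "\<dots> = (\<integral>x. A v x * g x \<partial>M) + (\<integral>x. \<bar>y x - A v x\<bar> \<partial>M)"
      by (rule Bochner_Integration.integral_add) (use y v int D_simps in auto)
    finally show ?thesis using yAv by linarith
  qed
  then show ?thesis by (rule field_le_epsilon)
qed

text \<open>The positive part lies within \<open>h\<close> of a finite combination of the indicators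
  of \<open>{v > k * h}\<close> with nonnegative weights. Each indicator is covered by
  \<open>indicator_test\<close>, and the error costs at most \<open>h\<close> times the norm of
  \<open>A v\<close>.\<close>

lemma positive_part_test:
  assumes v: "v \<in> D" and N: "AE x in M. v x \<le> N"
  shows "(\<integral>x. A v x * max (v x) 0 \<partial>M) \<ge> 0"
proof (rule field_le_epsilon)
  fix e :: real assume e: "e > 0"
  have [measurable]: "v \<in> borel_measurable M" using v D_simps by auto
  define K where "K = 1 + (\<integral>x. \<bar>A v x\<bar> \<partial>M)"
  have K: "K \<ge> 1" unfolding K_def by simp
  define h where "h = e / K"
  have h: "h > 0" unfolding h_def using e K by simp
  \<comment> \<open>Enough levels to pass the upper bound \<open>N\<close>, so that the step
    function is not saturated.\<close>
  obtain m :: nat where "real m > N / h" using reals_Archimedean2 by auto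
  then have m: "N < real m * h" using h by (simp add: divide_less_eq)
  define S where "S = (\<lambda>x. \<Sum>k<m. if real k * h < v x then h else 0)"
  have S: "AE x in M. max (v x) 0 \<le> S x \<and> S x \<le> max (v x) 0 + h"
    using N
  proof eventually_elim
    case (elim x)
    with m have "v x \<le> real m * h" by simp
    then show ?case unfolding S_def using Riemann_sum_indicators[OF h, of "v x" m] by auto
  qed
  have pos_bd: "AE x in M. \<bar>max (v x) 0\<bar> \<le> \<bar>N\<bar>"
    using N by eventually_elim auto
  have S_bd: "AE x in M. \<bar>S x\<bar> \<le> \<bar>N\<bar> + h"
    using N S by eventually_elim auto
  have [measurable]: "S \<in> borel_measurable M" unfolding S_def by measurable
  have int: "integrable M (\<lambda>x. A v x * S x)" "integrable M (\<lambda>x. A v x * max (v x) 0)"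
    by (auto intro!: integrable_mult_bounded[OF _ _ S_bd] integrable_mult_bounded[OF _ _ pos_bd]
        A_integrable v)
  have "(\<integral>x. A v x * S x \<partial>M) = (\<integral>x. (\<Sum>k<m. h * (A v x * (if real k * h < v x then 1 else 0))) \<partial>M)"
    unfolding S_def by (intro Bochner_Integration.integral_cong) (auto simp: sum_distrib_left intro!: sum.cong)
  also have "\<dots> = (\<Sum>k<m. \<integral>x. h * (A v x * (if real k * h < v x then 1 else 0)) \<partial>M)"
  proof (rule Bochner_Integration.integral_sum)
    show "integrable M (\<lambda>x. h * (A v x * (if real k * h < v x then 1 else 0)))" for k
      by (intro integrable_mult_right integrable_mult_bounded[where B = 1] A_integrable v) auto
  qed
  also have "\<dots> \<ge> 0"
  proof (rule sum_nonneg)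
    fix k
    have "0 \<le> (\<integral>x. A v x * (if real k * h < v x then 1 else 0) \<partial>M)"
      by (rule indicator_test[OF v, of "real k * h"]) (use h in auto)
    then show "0 \<le> (\<integral>x. h * (A v x * (if real k * h < v x then 1 else 0)) \<partial>M)"
      using h by simp
  qed
  finally have "0 \<le> (\<integral>x. A v x * S x \<partial>M)" .
  also have "\<dots> \<le> (\<integral>x. A v x * max (v x) 0 + h * \<bar>A v x\<bar> \<partial>M)"
  proof (rule integral_mono_AE)
    show "AE x in M. A v x * S x \<le> A v x * max (v x) 0 + h * \<bar>A v x\<bar>"
      using S
    proof eventually_elim
      case (elim x)
      have "A v x * (S x - max (v x) 0) \<le> \<bar>A v x\<bar> * (S x - max (v x) 0)"
        using elim by (intro mult_right_mono) auto
      also have "\<dots> \<le> \<bar>A v x\<bar> * h"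
        using elim by (intro mult_left_mono) auto
      finally show ?case by (simp add: algebra_simps)
    qed
  qed (use int v D_simps in auto)
  also have "\<dots> = (\<integral>x. A v x * max (v x) 0 \<partial>M) + h * (\<integral>x. \<bar>A v x\<bar> \<partial>M)"
    by (subst Bochner_Integration.integral_add) (use int v D_simps in auto)
  also have "h * (\<integral>x. \<bar>A v x\<bar> \<partial>M) \<le> h * K"
    using h unfolding K_def by (intro mult_left_mono) auto
  also have "h * K = e" unfolding h_def using K by simp
  finally show "0 \<le> (\<integral>x. A v x * max (v x) 0 \<partial>M) + e" by simp
qed

text \<open>The positive part test for \<open>v\<close> and for \<open>- v\<close> is combined
  through the decomposition of \<open>v\<close> into its positive and negative parts.\<close>

lemma bounded_monotone:
  assumes v: "v \<in> D" and N: "AE x in M. \<bar>v x\<bar> \<le> N"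
  shows "(\<integral>x. A v x * v x \<partial>M) \<ge> 0"
proof -
  have [measurable]: "v \<in> borel_measurable M" using v D_simps by auto
  have b: "AE x in M. v x \<le> N" "AE x in M. - v x \<le> N"
    using N by (eventually_elim, auto)+
  have bd: "AE x in M. \<bar>max (v x) 0\<bar> \<le> N" "AE x in M. \<bar>max (- v x) 0\<bar> \<le> N"
    using N by (eventually_elim, auto)+
  have int: "integrable M (\<lambda>x. A v x * max (v x) 0)" "integrable M (\<lambda>x. A v x * max (- v x) 0)"
    by (auto intro!: integrable_mult_bounded[OF _ _ bd(1)] integrable_mult_bounded[OF _ _ bd(2)]
        A_integrable v)
  have "0 \<le> (\<integral>x. A (\<lambda>x. - v x) x * max (- v x) 0 \<partial>M)"
    by (rule positive_part_test[OF minus_D[OF v] b(2)])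
  also have "\<dots> = (\<integral>x. - (A v x * max (- v x) 0) \<partial>M)"
  proof (rule integral_cong_AE)
    show "AE x in M. A (\<lambda>x. - v x) x * max (- v x) 0 = - (A v x * max (- v x) 0)"
      using A_minus[OF v] by eventually_elim simp
    have [measurable]: "A v \<in> borel_measurable M" "A (\<lambda>x. - v x) \<in> borel_measurable M"
      using v minus_D[OF v] D_simps by auto
    show "(\<lambda>x. A (\<lambda>x. - v x) x * max (- v x) 0) \<in> borel_measurable M"
      "(\<lambda>x. - (A v x * max (- v x) 0)) \<in> borel_measurable M" by measurable
  qed
  finally have "(\<integral>x. A v x * max (- v x) 0 \<partial>M) \<le> 0" by simp
  moreover have "0 \<le> (\<integral>x. A v x * max (v x) 0 \<partial>M)"
    by (rule positive_part_test[OF v b(1)])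
  moreover have "(\<integral>x. A v x * v x \<partial>M) = (\<integral>x. A v x * max (v x) 0 - A v x * max (- v x) 0 \<partial>M)"
    by (rule Bochner_Integration.integral_cong) (auto simp: max_def)
  ultimately show ?thesis using int by simp
qed

section \<open>Comparison and contraction\<close>

text \<open>Stated for any pair with \<open>mono\<close> instead of for subgradients, so that it
  covers terms such as \<open>u + e * v\<close> as well.\<close>

lemma comparison:
  assumes v: "v1 \<in> D" "v2 \<in> D"
    and int: "integrable M f1" "integrable M f2" "integrable M u1" "integrable M u2"
    and eq: "AE x in M. u1 x + A v1 x = f1 x" "AE x in M. u2 x + A v2 x = f2 x"
    and mono: "AE x in M. (u1 x - u2 x) * (v1 x - v2 x) \<ge> 0"
  shows "(\<integral>x. max (u1 x - u2 x) 0 \<partial>M) \<le> (\<integral>x. max (f1 x - f2 x) 0 \<partial>M)"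
proof -
  define w where "w = (\<lambda>x. v1 x - v2 x)"
  have w: "w \<in> D" unfolding w_def by (rule diff_D[OF v])
  have [measurable]: "u1 \<in> borel_measurable M" "u2 \<in> borel_measurable M" "w \<in> borel_measurable M"
    using int w D_simps by auto
  \<comment> \<open>Where \<open>w\<close> vanishes, \<open>mono\<close> leaves the sign of
    \<open>u1 - u2\<close> open, and \<open>g\<close> follows that sign. Thus
    \<open>(u1 - u2) * g\<close> is the positive part of \<open>u1 - u2\<close> almost everywhere,
    while \<open>(f1 - f2) * g\<close> is at most that of \<open>f1 - f2\<close>.\<close>
  define g :: "'a \<Rightarrow> real" where "g = (\<lambda>x. if w x > 0 \<or> (w x = 0 \<and> u1 x > u2 x) then 1 else 0)"
  have [measurable]: "g \<in> borel_measurable M" unfolding g_def by measurable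
  have "0 \<le> (\<integral>x. A w x * g x \<partial>M)"
    by (rule indicator_test[OF w, of 0]) (auto simp: g_def)
  also have "\<dots> \<le> (\<integral>x. max (f1 x - f2 x) 0 - max (u1 x - u2 x) 0 \<partial>M)"
  proof (rule integral_mono_AE)
    show "integrable M (\<lambda>x. A w x * g x)"
      by (rule integrable_mult_bounded[where B = 1]) (use w D_simps in \<open>auto simp: g_def\<close>)
    show "AE x in M. A w x * g x \<le> max (f1 x - f2 x) 0 - max (u1 x - u2 x) 0"
      using A_diff[OF v] eq mono
    proof eventually_elim
      case (elim x)
      have Aw: "A w x = (f1 x - f2 x) - (u1 x - u2 x)"
        using elim unfolding w_def by simp
      have "w x > 0 \<Longrightarrow> u1 x \<ge> u2 x" "w x < 0 \<Longrightarrow> u1 x \<le> u2 x"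
        using elim(4) unfolding w_def by (auto simp: zero_le_mult_iff)
      then show ?case unfolding Aw g_def by (cases "w x" "0::real" rule: linorder_cases) auto
    qed
  qed (use int in auto)
  also have "\<dots> = (\<integral>x. max (f1 x - f2 x) 0 \<partial>M) - (\<integral>x. max (u1 x - u2 x) 0 \<partial>M)"
    by (rule Bochner_Integration.integral_diff) (use int in auto)
  finally show ?thesis by simp
qed

lemma contraction:
  assumes v: "v1 \<in> D" "v2 \<in> D"
    and int: "integrable M f1" "integrable M f2" "integrable M u1" "integrable M u2"
    and eq: "AE x in M. u1 x + A v1 x = f1 x" "AE x in M. u2 x + A v2 x = f2 x"
    and mono: "AE x in M. (u1 x - u2 x) * (v1 x - v2 x) \<ge> 0"
  shows "(\<integral>x. \<bar>u1 x - u2 x\<bar> \<partial>M) \<le> (\<integral>x. \<bar>f1 x - f2 x\<bar> \<partial>M)"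
proof -
  have "AE x in M. (u2 x - u1 x) * (v2 x - v1 x) \<ge> 0"
    using mono by eventually_elim (simp add: algebra_simps)
  from comparison[OF v(2,1) int(2,1,4,3) eq(2,1) this] comparison[OF v int eq mono]
  show ?thesis
    using integral_abs_eq_parts[of M "\<lambda>x. u1 x - u2 x"] integral_abs_eq_parts[of M "\<lambda>x. f1 x - f2 x"] int
    by simp
qed

end

section \<open>Solvability of the inclusion\<close>

text \<open>\<open>p_growth\<close> asks for a real majorant with integrable square, so the
  extended-valued supremum appears only when the locale is instantiated.\<close>

locale L1_convex_problem = L1_operator M D A c
  for M :: "'a measure" and D A and c :: real +
  fixes p :: "'a \<Rightarrow> real \<Rightarrow> real"
  assumes p_convex: "x \<in> space M \<Longrightarrow> convex_on UNIV (p x)"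
    and p_nonneg: "x \<in> space M \<Longrightarrow> p x s \<ge> 0"
    and p_zero: "x \<in> space M \<Longrightarrow> p x 0 = 0"
    and p_measurable: "(\<lambda>x. p x s) \<in> borel_measurable M"
    and p_growth: "C > 0 \<Longrightarrow> \<exists>m. integrable M (\<lambda>x. (m x)\<^sup>2) \<and>
      (AE x in M. \<forall>v u. u \<in> subdiff (p x) v \<longrightarrow> \<bar>v\<bar> \<le> C \<longrightarrow> \<bar>u\<bar> \<le> m x)"
begin

text \<open>Two successive extractions of subsequences turn both convergences in \<open>L1\<close>
  into convergence almost everywhere along common indices; there the pointwise
  \<open>subdiff_closed\<close> applies.\<close>

lemma subdiff_limit:
  assumes int: "\<And>n. integrable M (u n)" "\<And>n. integrable M (y n)" "integrable M u0" "integrable M y0"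
    and lim: "(\<lambda>n. \<integral>x. \<bar>u n x - u0 x\<bar> \<partial>M) \<longlonglongrightarrow> 0" "(\<lambda>n. \<integral>x. \<bar>y n x - y0 x\<bar> \<partial>M) \<longlonglongrightarrow> 0"
    and sub: "\<And>n. AE x in M. u n x \<in> subdiff (p x) (y n x)"
  shows "AE x in M. u0 x \<in> subdiff (p x) (y0 x)"
proof -
  obtain r where r: "strict_mono r" "AE x in M. (\<lambda>n. u (r n) x - u0 x) \<longlonglongrightarrow> 0"
    using tendsto_L1_AE_subseq[of M "\<lambda>n x. u n x - u0 x"] int lim by auto
  have "(\<lambda>n. \<integral>x. \<bar>y (r n) x - y0 x\<bar> \<partial>M) \<longlonglongrightarrow> 0"
    using LIMSEQ_subseq_LIMSEQ[OF lim(2) r(1)] by (simp add: o_def)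
  then obtain r' where r': "strict_mono r'" "AE x in M. (\<lambda>n. y (r (r' n)) x - y0 x) \<longlonglongrightarrow> 0"
    using tendsto_L1_AE_subseq[of M "\<lambda>n x. y (r n) x - y0 x"] int by auto
  have "AE x in M. \<forall>n. u n x \<in> subdiff (p x) (y n x)"
    using sub by (simp add: AE_all_countable)
  moreover have "AE x in M. x \<in> space M" by simp
  ultimately show ?thesis
    using r(2) r'(2)
  proof eventually_elim
    case (elim x)
    have "(\<lambda>n. u (r n) x) \<longlonglongrightarrow> u0 x" using elim(3) by (rule LIM_zero_cancel)
    then have 1: "(\<lambda>n. u (r (r' n)) x) \<longlonglongrightarrow> u0 x"
      using LIMSEQ_subseq_LIMSEQ[OF _ r'(1), of "\<lambda>n. u (r n) x"] by (simp add: o_def)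
    have 2: "(\<lambda>n. y (r (r' n)) x) \<longlonglongrightarrow> y0 x" using elim(4) by (rule LIM_zero_cancel)
    show ?case
      by (rule subdiff_closed[OF convex_on_continuous[OF open_UNIV p_convex] _ 1 2]) (use elim in auto)
  qed
qed

section \<open>The Yosida approximation of the equation\<close>

text \<open>The superposition operator of the proximal maps; \<open>(v x - J l v x) / l\<close> is
  the Yosida approximation applied to \<open>v\<close>.\<close>

definition J :: "real \<Rightarrow> ('a \<Rightarrow> real) \<Rightarrow> 'a \<Rightarrow> real" where
  "J l v x = prox l (p x) (v x)"

lemma J_subdiff: "l > 0 \<Longrightarrow> x \<in> space M \<Longrightarrow> (v x - J l v x) / l \<in> subdiff (p x) (J l v x)"
  unfolding J_def by (intro prox_subdiff p_convex p_nonneg p_zero)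

lemma J_nonexpansive: "l > 0 \<Longrightarrow> x \<in> space M \<Longrightarrow> \<bar>J l v x - J l w x\<bar> \<le> \<bar>v x - w x\<bar>"
  unfolding J_def by (intro prox_nonexpansive p_convex p_nonneg p_zero)

lemma J_abs_le: "l > 0 \<Longrightarrow> x \<in> space M \<Longrightarrow> \<bar>J l v x\<bar> \<le> \<bar>v x\<bar>"
  unfolding J_def by (intro prox_abs_le p_convex p_nonneg p_zero)

lemma J_integrable:
  assumes l: "l > 0" and v: "integrable M v"
  shows "integrable M (J l v)"
proof (rule Bochner_Integration.integrable_bound[OF v])
  show "J l v \<in> borel_measurable M"
    unfolding J_def by (rule prox_measurable[OF p_convex p_nonneg p_zero p_measurable l]) (use v in auto)
  show "AE x in M. norm (J l v x) \<le> norm (v x)"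
    using J_abs_le[OF l] by (intro AE_I2) simp
qed

text \<open>Multiplying by \<open>l * k\<close> with \<open>k = 1 / (1 + l * e)\<close> rewrites the
  equation as \<open>v + \<rho> * A v = k * (J l v + l * f)\<close> with
  \<open>\<rho> = l * k\<close>. The resolvent and \<open>J l\<close> are nonexpansive, so the
  resulting fixed point map contracts by the factor \<open>k < 1\<close>.\<close>

lemma Yosida_solution_ex:
  assumes e: "e > 0" and l: "l > 0" and f: "integrable M f"
  shows "\<exists>v\<in>D. AE x in M. e * v x + (v x - J l v x) / l + A v x = f x"
proof -
  define k where "k = 1 / (1 + l * e)"
  have le: "l * e > 0" using e l by simp
  have k: "k > 0" "k < 1" unfolding k_def using le by (auto simp: field_simps)
  define \<rho> where "\<rho> = l * k"
  have \<rho>: "\<rho> > 0" unfolding \<rho>_def using l k by simp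
  have "\<exists>z\<in>D. AE x in M. z x + \<rho> * A z x = k * (J l v x + l * f x)" if "integrable M v" for v
    by (rule range[OF _ \<rho>]) (use J_integrable[OF l that] f in auto)
  then obtain T where T: "\<And>v. integrable M v \<Longrightarrow> T v \<in> D"
    "\<And>v. integrable M v \<Longrightarrow> AE x in M. T v x + \<rho> * A (T v) x = k * (J l v x + l * f x)"
    by metis
  have J_lip: "(\<integral>x. \<bar>J l v x - J l w x\<bar> \<partial>M) \<le> (\<integral>x. \<bar>v x - w x\<bar> \<partial>M)"
    if "integrable M v" "integrable M w" for v w
    by (rule integral_mono_AE) (use that J_integrable[OF l] J_nonexpansive[OF l] in auto)
  have T_lip: "(\<integral>x. \<bar>T v x - T w x\<bar> \<partial>M) \<le> k * (\<integral>x. \<bar>v x - w x\<bar> \<partial>M)"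
    if v: "integrable M v" and w: "integrable M w" for v w
  proof -
    have "(\<integral>x. \<bar>T v x - T w x\<bar> \<partial>M)
        \<le> (\<integral>x. \<bar>(T v x + \<rho> * A (T v) x) - (T w x + \<rho> * A (T w) x)\<bar> \<partial>M)"
      by (rule accretive_diff[OF T(1)[OF v] T(1)[OF w] \<rho>])
    also have "\<dots> = (\<integral>x. \<bar>k * (J l v x - J l w x)\<bar> \<partial>M)"
    proof (rule AE_eq_integral_abs)
      show "AE x in M. (T v x + \<rho> * A (T v) x) - (T w x + \<rho> * A (T w) x) = k * (J l v x - J l w x)"
        using T(2)[OF v] T(2)[OF w] by eventually_elim (simp add: algebra_simps)
    qed (use T(1)[OF v] T(1)[OF w] D_simps J_integrable[OF l v] J_integrable[OF l w] in auto)
    also have "\<dots> = k * (\<integral>x. \<bar>J l v x - J l w x\<bar> \<partial>M)"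
      using k by (simp add: abs_mult)
    also have "\<dots> \<le> k * (\<integral>x. \<bar>v x - w x\<bar> \<partial>M)"
      using J_lip[OF v w] k by simp
    finally show ?thesis .
  qed
  define s where "s = (\<lambda>n. (T ^^ n) (\<lambda>x. 0))"
  have s_Suc: "s (Suc n) = T (s n)" for n unfolding s_def by simp
  have s_D: "s n \<in> D" for n
    by (induction n) (auto simp: s_Suc zero_D T(1) D_integrable, auto simp: s_def zero_D)
  note s_int = D_integrable[OF s_D]
  define K where "K = (\<integral>x. \<bar>s 1 x - s 0 x\<bar> \<partial>M)"
  have step: "(\<integral>x. \<bar>s (Suc n) x - s n x\<bar> \<partial>M) \<le> K * k ^ n" for n
  proof (induction n)
    case (Suc n)
    have "(\<integral>x. \<bar>s (Suc (Suc n)) x - s (Suc n) x\<bar> \<partial>M) \<le> k * (\<integral>x. \<bar>s (Suc n) x - s n x\<bar> \<partial>M)"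
      using T_lip[OF s_int s_int, of "Suc n" n] by (simp add: s_Suc)
    also have "\<dots> \<le> k * (K * k ^ n)" using Suc k by simp
    finally show ?case by (simp add: algebra_simps)
  qed (simp add: K_def)
  have "summable (\<lambda>n. \<integral>x. \<bar>s (Suc n) x - s n x\<bar> \<partial>M)"
  proof (rule summable_comparison_test)
    show "\<exists>N. \<forall>n\<ge>N. norm (\<integral>x. \<bar>s (Suc n) x - s n x\<bar> \<partial>M) \<le> K * k ^ n"
      using step by auto
    show "summable (\<lambda>n. K * k ^ n)" using k by (intro summable_mult summable_geometric) auto
  qed
  from L1_limit_of_summable_steps[of M s, OF s_int this]
  obtain v where v: "integrable M v" and lim: "(\<lambda>n. \<integral>x. \<bar>s n x - v x\<bar> \<partial>M) \<longlonglongrightarrow> 0"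
    by (elim exE conjE)
  have lim': "(\<lambda>n. \<integral>x. \<bar>s (Suc n) x - v x\<bar> \<partial>M) \<longlonglongrightarrow> 0" by (rule LIMSEQ_Suc[OF lim])
  \<comment> \<open>The value that the fixed point equation prescribes for \<open>A v\<close>; the
    iterates satisfy the analogous formula, and closedness of the graph identifies the
    limit.\<close>
  define h where "h = (\<lambda>x. (k * (J l v x + l * f x) - v x) / \<rho>)"
  have h: "integrable M h" unfolding h_def using J_integrable[OF l v] v f by auto
  have A_lim: "(\<lambda>n. \<integral>x. \<bar>A (s (Suc n)) x - h x\<bar> \<partial>M) \<longlonglongrightarrow> 0"
  proof (rule tendsto_sandwich[OF _ _ tendsto_const])
    have "(\<integral>x. \<bar>A (s (Suc n)) x - h x\<bar> \<partial>M)
        \<le> 1 / \<rho> * (k * (\<integral>x. \<bar>s n x - v x\<bar> \<partial>M) + (\<integral>x. \<bar>s (Suc n) x - v x\<bar> \<partial>M))" for n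
    proof -
      have int: "integrable M (\<lambda>x. \<bar>J l (s n) x - J l v x\<bar>)" "integrable M (\<lambda>x. \<bar>s (Suc n) x - v x\<bar>)"
        using J_integrable[OF l s_int] J_integrable[OF l v] s_int v by auto
      have "(\<integral>x. \<bar>A (s (Suc n)) x - h x\<bar> \<partial>M)
          \<le> (\<integral>x. 1 / \<rho> * (k * \<bar>J l (s n) x - J l v x\<bar> + \<bar>s (Suc n) x - v x\<bar>) \<partial>M)"
      proof (rule integral_mono_AE)
        show "AE x in M. \<bar>A (s (Suc n)) x - h x\<bar>
            \<le> 1 / \<rho> * (k * \<bar>J l (s n) x - J l v x\<bar> + \<bar>s (Suc n) x - v x\<bar>)"
          using T(2)[OF s_int[of n]]
        proof eventually_elim
          case (elim x)
          have "\<rho> * A (s (Suc n)) x = k * (J l (s n) x + l * f x) - s (Suc n) x"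
            using elim by (simp add: s_Suc)
          then have "A (s (Suc n)) x = (k * (J l (s n) x + l * f x) - s (Suc n) x) / \<rho>"
            using \<rho> by (simp add: field_simps)
          then have "A (s (Suc n)) x - h x
              = 1 / \<rho> * ((k * (J l (s n) x + l * f x) - s (Suc n) x) - (k * (J l v x + l * f x) - v x))"
            unfolding h_def by (simp only: diff_divide_distrib[symmetric]) simp
          also have "(k * (J l (s n) x + l * f x) - s (Suc n) x) - (k * (J l v x + l * f x) - v x)
              = k * (J l (s n) x - J l v x) - (s (Suc n) x - v x)"
            by (simp add: algebra_simps)
          finally have "A (s (Suc n)) x - h x
              = 1 / \<rho> * (k * (J l (s n) x - J l v x) - (s (Suc n) x - v x))" .
          then have "\<bar>A (s (Suc n)) x - h x\<bar> = 1 / \<rho> * \<bar>k * (J l (s n) x - J l v x) - (s (Suc n) x - v x)\<bar>"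
            using \<rho> by (simp add: abs_mult)
          also have "\<dots> \<le> 1 / \<rho> * (\<bar>k * (J l (s n) x - J l v x)\<bar> + \<bar>s (Suc n) x - v x\<bar>)"
            using \<rho> by (intro mult_left_mono abs_triangle_ineq4) auto
          finally show ?case using k by (simp add: abs_mult)
        qed
      qed (use int h s_D D_simps in auto)
      also have "\<dots> = 1 / \<rho> * (k * (\<integral>x. \<bar>J l (s n) x - J l v x\<bar> \<partial>M) + (\<integral>x. \<bar>s (Suc n) x - v x\<bar> \<partial>M))"
        using int by simp
      also have "\<dots> \<le> 1 / \<rho> * (k * (\<integral>x. \<bar>s n x - v x\<bar> \<partial>M) + (\<integral>x. \<bar>s (Suc n) x - v x\<bar> \<partial>M))"
        using J_lip[OF s_int v, of n] k \<rho> by (intro mult_left_mono add_right_mono) auto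
      finally show ?thesis .
    qed
    then show "\<forall>\<^sub>F n in sequentially. (\<integral>x. \<bar>A (s (Suc n)) x - h x\<bar> \<partial>M)
        \<le> 1 / \<rho> * (k * (\<integral>x. \<bar>s n x - v x\<bar> \<partial>M) + (\<integral>x. \<bar>s (Suc n) x - v x\<bar> \<partial>M))" by simp
    have "(\<lambda>n. 1 / \<rho> * (k * (\<integral>x. \<bar>s n x - v x\<bar> \<partial>M) + (\<integral>x. \<bar>s (Suc n) x - v x\<bar> \<partial>M)))
        \<longlonglongrightarrow> 1 / \<rho> * (k * 0 + 0)"
      by (intro tendsto_intros lim lim')
    then show "(\<lambda>n. 1 / \<rho> * (k * (\<integral>x. \<bar>s n x - v x\<bar> \<partial>M) + (\<integral>x. \<bar>s (Suc n) x - v x\<bar> \<partial>M))) \<longlonglongrightarrow> 0"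
      by simp
  qed simp
  have "v \<in> D" and Av: "AE x in M. A v x = h x"
    using closed[OF s_D v h lim' A_lim] by auto
  have "AE x in M. e * v x + (v x - J l v x) / l + A v x = f x"
    using Av
  proof eventually_elim
    case (elim x)
    then have "A v x = (k * (J l v x + l * f x) - v x) / (l * k)" unfolding h_def \<rho>_def .
    then have "l * A v x = (k * (J l v x + l * f x) - v x) / k" using l k by simp
    also have "\<dots> = J l v x + l * f x - v x / k" using k by (simp add: diff_divide_distrib)
    also have "v x / k = (1 + l * e) * v x" unfolding k_def by simp
    finally have "l * A v x = J l v x + l * f x - (1 + l * e) * v x" .
    then have "l * (e * v x + (v x - J l v x) / l + A v x) = l * f x"
      using l by (simp add: field_simps)
    then show ?case using l by simp
  qed
  with \<open>v \<in> D\<close> show ?thesis by blast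
qed

section \<open>Uniform bounds and existence for bounded data\<close>

text \<open>A weak maximum principle: on \<open>{v > N / e}\<close> the equation forces
  \<open>A v \<le> - e * (v - N / e)\<close>, while the integral of \<open>A v\<close> over this set
  is nonnegative.\<close>

lemma upper_bound:
  assumes v: "v \<in> D" and e: "e > 0" and N: "N \<ge> 0"
    and u: "AE x in M. v x > 0 \<longrightarrow> u x \<ge> 0" and f: "AE x in M. f x \<le> N"
    and eq: "AE x in M. e * v x + u x + A v x = f x"
  shows "AE x in M. v x \<le> N / e"
proof -
  have [measurable]: "v \<in> borel_measurable M" using v D_simps by auto
  define g :: "'a \<Rightarrow> real" where "g = (\<lambda>x. if v x > N / e then 1 else 0)"
  have [measurable]: "g \<in> borel_measurable M" unfolding g_def by measurable
  have int: "integrable M (\<lambda>x. max (v x - N / e) 0)" using v D_simps by auto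
  have "0 \<le> (\<integral>x. A v x * g x \<partial>M)"
    by (rule indicator_test[OF v, of "N / e"]) (use e N in \<open>auto simp: g_def\<close>)
  also have "\<dots> \<le> (\<integral>x. - (e * max (v x - N / e) 0) \<partial>M)"
  proof (rule integral_mono_AE)
    show "integrable M (\<lambda>x. A v x * g x)"
      by (rule integrable_mult_bounded[where B = 1]) (use v D_simps in \<open>auto simp: g_def\<close>)
    show "AE x in M. A v x * g x \<le> - (e * max (v x - N / e) 0)"
      using u f eq
    proof eventually_elim
      case (elim x)
      show ?case
      proof (cases "v x > N / e")
        case True
        moreover have "N / e \<ge> 0" using N e by simp
        ultimately have "A v x \<le> N - e * v x" using elim by linarith
        also have "\<dots> = - (e * (v x - N / e))" using e by (simp add: algebra_simps)
        finally show ?thesis using True unfolding g_def by simp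
      qed (auto simp: g_def)
    qed
  qed (use int in auto)
  finally have "(\<integral>x. max (v x - N / e) 0 \<partial>M) \<le> 0" using e by (simp add: mult_le_0_iff)
  then have "(\<integral>x. \<bar>max (v x - N / e) 0 - 0\<bar> \<partial>M) \<le> 0" by simp
  from L1_zero_AE_eq[OF int _ this] have "AE x in M. max (v x - N / e) 0 = 0" by simp
  then show ?thesis by eventually_elim auto
qed

lemma abs_bound:
  assumes v: "v \<in> D" and e: "e > 0" and N: "N \<ge> 0"
    and u: "AE x in M. u x * v x \<ge> 0" and f: "AE x in M. \<bar>f x\<bar> \<le> N"
    and eq: "AE x in M. e * v x + u x + A v x = f x"
  shows "AE x in M. \<bar>v x\<bar> \<le> N / e"
proof -
  have "AE x in M. v x \<le> N / e"
  proof (rule upper_bound[OF v e N _ _ eq])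
    show "AE x in M. v x > 0 \<longrightarrow> u x \<ge> 0"
      using u by eventually_elim (auto simp: zero_le_mult_iff)
    show "AE x in M. f x \<le> N" using f by eventually_elim auto
  qed
  moreover have "AE x in M. - v x \<le> N / e"
  proof (rule upper_bound[OF minus_D[OF v] e N])
    show "AE x in M. - v x > 0 \<longrightarrow> - u x \<ge> 0"
      using u by eventually_elim (auto simp: zero_le_mult_iff)
    show "AE x in M. - f x \<le> N" using f by eventually_elim auto
    show "AE x in M. e * - v x + - u x + A (\<lambda>x. - v x) x = - f x"
      using A_minus[OF v] eq by eventually_elim simp
  qed
  ultimately show ?thesis by eventually_elim auto
qed

text \<open>The term \<open>e * v\<close> bounds the Yosida solutions uniformly, so the growth
  condition dominates all \<open>U n\<close> by one square-integrable function. The regularisation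
  parameter then tends to zero with \<open>e\<close> fixed.\<close>

lemma bounded_data_solution_ex:
  assumes e: "e > 0" and f: "integrable M f" and N: "N > 0" "AE x in M. \<bar>f x\<bar> \<le> N"
  shows "\<exists>v\<in>D. \<exists>u. integrable M u \<and> (AE x in M. e * v x + u x + A v x = f x) \<and>
    (AE x in M. u x \<in> subdiff (p x) (v x))"
proof -
  define l where "l = (\<lambda>n. 1 / real (Suc n))"
  have l: "l n > 0" "l n \<le> 1" for n unfolding l_def by auto
  have l_less: "l m < l n" if "n < m" for m n
    unfolding l_def using that by (auto intro!: divide_strict_left_mono)
  have l_lim: "l \<longlonglongrightarrow> 0" unfolding l_def by (rule LIMSEQ_inverse_real_of_nat[unfolded inverse_eq_divide])
  have "\<forall>n. \<exists>v. v \<in> D \<and> (AE x in M. e * v x + (v x - J (l n) v x) / l n + A v x = f x)"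
    using Yosida_solution_ex[OF e l(1) f] by (simp add: Bex_def)
  from choice[OF this] obtain V where V: "\<And>n. V n \<in> D"
    "\<And>n. AE x in M. e * V n x + (V n x - J (l n) (V n) x) / l n + A (V n) x = f x"
    by auto
  define Y where "Y = (\<lambda>n. J (l n) (V n))"
  define U where "U = (\<lambda>n x. (V n x - Y n x) / l n)"
  note V_int = D_integrable[OF V(1)]
  have Y_int: "integrable M (Y n)" for n unfolding Y_def by (rule J_integrable[OF l(1) V_int])
  have U_int: "integrable M (U n)" for n unfolding U_def using Y_int V_int by auto
  have [measurable]: "V n \<in> borel_measurable M" "Y n \<in> borel_measurable M" "U n \<in> borel_measurable M" for n
    using V_int Y_int U_int by auto
  have eq: "AE x in M. e * V n x + U n x + A (V n) x = f x" for n
    using V(2)[of n] unfolding U_def Y_def .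
  have V_eq: "V n x = Y n x + l n * U n x" for n x
    unfolding U_def using l(1)[of n] by simp
  have sub: "AE x in M. U n x \<in> subdiff (p x) (Y n x)" for n
    unfolding U_def Y_def using J_subdiff[OF l(1)] by (intro AE_I2)
  define C where "C = N / e"
  have C: "C > 0" unfolding C_def using N e by simp
  have V_le: "AE x in M. \<bar>V n x\<bar> \<le> C" for n
    unfolding C_def
  proof (rule abs_bound[OF V(1) e _ _ N(2) eq])
    \<comment> \<open>As \<open>\<bar>Y n x\<bar> \<le> \<bar>V n x\<bar>\<close>, the difference
      \<open>V n x - Y n x\<close> is zero or has the sign of \<open>V n x\<close>.\<close>
    show "AE x in M. U n x * V n x \<ge> 0"
    proof (rule AE_I2)
      fix x assume "x \<in> space M"
      then have "\<bar>Y n x\<bar> \<le> \<bar>V n x\<bar>" unfolding Y_def by (rule J_abs_le[OF l(1)])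
      then have "(V n x - Y n x) * V n x \<ge> 0" by (auto simp: zero_le_mult_iff)
      then show "U n x * V n x \<ge> 0" unfolding U_def using l(1)[of n] by simp
    qed
  qed (use N in simp)
  have Y_le: "AE x in M. \<bar>Y n x\<bar> \<le> C" for n
    using V_le[of n] AE_space
  proof eventually_elim
    case (elim x)
    then show ?case using J_abs_le[OF l(1) elim(2), of n "V n"] unfolding Y_def by linarith
  qed
  obtain m where m: "integrable M (\<lambda>x. (m x)\<^sup>2)"
    "AE x in M. \<forall>v u. u \<in> subdiff (p x) v \<longrightarrow> \<bar>v\<bar> \<le> C \<longrightarrow> \<bar>u\<bar> \<le> m x"
    using p_growth[OF C] by blast
  have U_le: "AE x in M. \<bar>U n x\<bar> \<le> m x" for n
    using m(2) sub[of n] Y_le[of n] by eventually_elim blast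
  have sq_le: "AE x in M. \<bar>a x * b x\<bar> \<le> B * (m x)\<^sup>2"
    if ab: "AE x in M. \<bar>a x\<bar> \<le> k * m x" "AE x in M. \<bar>b x\<bar> \<le> k * m x" "B = k * k" for a b :: "'a \<Rightarrow> real" and k B
    using ab(1,2)
  proof eventually_elim
    case (elim x)
    have "\<bar>a x * b x\<bar> = \<bar>a x\<bar> * \<bar>b x\<bar>" by (rule abs_mult)
    also have "\<dots> \<le> (k * m x) * (k * m x)" using elim by (intro mult_mono) auto
    finally show ?case using ab(3) by (simp add: power2_eq_square algebra_simps)
  qed
  have prod_int: "integrable M (\<lambda>x. a x * b x)"
    if ab: "AE x in M. \<bar>a x\<bar> \<le> k * m x" "AE x in M. \<bar>b x\<bar> \<le> k * m x"
      and [measurable]: "a \<in> borel_measurable M" "b \<in> borel_measurable M" for a b :: "'a \<Rightarrow> real" and k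
  proof (rule Bochner_Integration.integrable_bound)
    show "integrable M (\<lambda>x. (k * k) * (m x)\<^sup>2)" using m(1) by simp
    show "AE x in M. norm (a x * b x) \<le> norm ((k * k) * (m x)\<^sup>2)"
      using sq_le[OF ab refl] by eventually_elim auto
  qed measurable
  have U_le1: "AE x in M. \<bar>U n x\<bar> \<le> 1 * m x" for n using U_le by simp
  have UU_int: "integrable M (\<lambda>x. U n x * U k x)" for n k
    by (rule prod_int[OF U_le1 U_le1]) measurable
  have U2_int: "integrable M (\<lambda>x. (U n x)\<^sup>2)" for n
    using UU_int[of n n] by (simp add: power2_eq_square)
  \<comment> \<open>The difference of two equations is paired with \<open>w\<close>, split as
    \<open>(Y n - Y k) + (l n * U n - l k * U k)\<close>. The terms with \<open>e * w * w\<close>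
    and with \<open>Y n - Y k\<close> have a favourable sign, and the integral of
    \<open>A w * w\<close> is nonnegative.\<close>
  have obtuse: "(\<integral>x. (U n x - U k x) * (l n * U n x - l k * U k x) \<partial>M) \<le> 0" for n k
  proof -
    define w where "w = (\<lambda>x. V n x - V k x)"
    have w: "w \<in> D" unfolding w_def by (rule diff_D[OF V(1) V(1)])
    have w_le: "AE x in M. \<bar>w x\<bar> \<le> 2 * C"
      using V_le[of n] V_le[of k] unfolding w_def by eventually_elim auto
    have int: "integrable M (\<lambda>x. (U n x - U k x) * (l n * U n x - l k * U k x))"
    proof -
      have "AE x in M. \<bar>U n x - U k x\<bar> \<le> 2 * m x"
        using U_le[of n] U_le[of k] by eventually_elim auto
      moreover have "AE x in M. \<bar>l n * U n x - l k * U k x\<bar> \<le> 2 * m x"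
        using U_le[of n] U_le[of k]
      proof eventually_elim
        case (elim x)
        have "\<bar>l i * U i x\<bar> \<le> \<bar>U i x\<bar>" for i
          using mult_right_mono[OF l(2), of "\<bar>U i x\<bar>" i] l(1)[of i] by (simp add: abs_mult)
        from this[of n] this[of k] show ?case using elim by linarith
      qed
      ultimately show ?thesis by (rule prod_int) measurable
    qed
    have "0 \<le> (\<integral>x. A w x * w x \<partial>M)" by (rule bounded_monotone[OF w w_le])
    also have "\<dots> \<le> (\<integral>x. - ((U n x - U k x) * (l n * U n x - l k * U k x)) \<partial>M)"
    proof (rule integral_mono_AE)
      show "integrable M (\<lambda>x. A w x * w x)"
        by (rule integrable_mult_bounded[OF _ _ w_le]) (use w D_simps in auto)
      show "AE x in M. A w x * w x \<le> - ((U n x - U k x) * (l n * U n x - l k * U k x))"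
        using A_diff[OF V(1) V(1), of n k] eq[of n] eq[of k] sub[of n] sub[of k]
      proof eventually_elim
        case (elim x)
        have Aw: "A w x = - (e * w x) - (U n x - U k x)"
          using elim unfolding w_def by (simp add: algebra_simps)
        have w_eq: "w x = (Y n x - Y k x) + (l n * U n x - l k * U k x)"
          unfolding w_def by (simp add: V_eq)
        have expand: "(- (e * a) - d) * a = - (e * (a * a)) - d * y - d * z" if "a = y + z" for a d y z
          unfolding that by (simp add: algebra_simps)
        have "A w x * w x = - (e * (w x * w x)) - (U n x - U k x) * (Y n x - Y k x)
            - (U n x - U k x) * (l n * U n x - l k * U k x)"
          unfolding Aw by (rule expand[OF w_eq])
        moreover have "(U n x - U k x) * (Y n x - Y k x) \<ge> 0"
          by (rule subdiff_mono[OF elim(4,5)])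
        moreover have "e * (w x * w x) \<ge> 0" using e by simp
        ultimately show ?case by linarith
      qed
    qed (use int in auto)
    finally show ?thesis by simp
  qed
  define S where "S = (\<lambda>n. \<integral>x. (U n x)\<^sup>2 \<partial>M)"
  \<comment> \<open>A larger index means a smaller parameter, so \<open>S\<close> increases and its
    increments control squared distances.\<close>
  have S_diff: "(\<integral>x. (U n x - U k x)\<^sup>2 \<partial>M) \<le> S k - S n" if "n \<le> k" for n k
  proof (cases "n = k")
    case False
    with that have "n < k" by simp
    then show ?thesis unfolding S_def
      by (intro L2_difference_le[OF U2_int U2_int UU_int l_less l(1) obtuse])
  qed simp
  have "S n \<le> S k" if "n \<le> k" for n k
  proof -
    have "0 \<le> (\<integral>x. (U n x - U k x)\<^sup>2 \<partial>M)" by simp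
    with S_diff[OF that] show ?thesis by linarith
  qed
  then have S_inc: "incseq S" by (simp add: incseq_def)
  have S_bd: "S n \<le> (\<integral>x. (m x)\<^sup>2 \<partial>M)" for n
    unfolding S_def
  proof (rule integral_mono_AE[OF U2_int m(1)])
    show "AE x in M. (U n x)\<^sup>2 \<le> (m x)\<^sup>2"
      using U_le[of n]
    proof eventually_elim
      case (elim x)
      then have "\<bar>U n x\<bar>\<^sup>2 \<le> (m x)\<^sup>2" by (rule power_mono) simp
      then show ?case by simp
    qed
  qed
  obtain L where "S \<longlonglongrightarrow> L" by (rule incseq_convergent[OF S_inc]) (use S_bd in auto)
  then have S_Cauchy: "Cauchy S" by (rule LIMSEQ_imp_Cauchy)
  have U_Cauchy: "\<exists>K. \<forall>n\<ge>K. \<forall>k\<ge>K. (\<integral>x. \<bar>U n x - U k x\<bar> \<partial>M) < d" if d: "d > 0" for d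
  proof -
    define c0 where "c0 = measure M (space M) + 1"
    have c0: "c0 \<ge> 1" unfolding c0_def by simp
    \<comment> \<open>On a finite measure space
      \<open>\<bar>s\<bar> \<le> \<delta> + s\<^sup>2 / \<delta>\<close> turns smallness in
      \<open>L2\<close> into smallness in \<open>L1\<close>; this \<open>\<delta>\<close> makes the
      constant part contribute at most \<open>d / 2\<close>.\<close>
    define \<delta> where "\<delta> = d / (2 * c0)"
    have \<delta>: "\<delta> > 0" unfolding \<delta>_def using d c0 by simp
    have "\<delta> * d / 2 > 0" using \<delta> d by simp
    from metric_CauchyD[OF S_Cauchy this] obtain K where
      K: "\<And>n k. n \<ge> K \<Longrightarrow> k \<ge> K \<Longrightarrow> \<bar>S n - S k\<bar> < \<delta> * d / 2" by (auto simp: dist_real_def)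
    have "(\<integral>x. \<bar>U n x - U k x\<bar> \<partial>M) < d" if nk: "n \<ge> K" "k \<ge> K" for n k
    proof -
      have L2: "(\<integral>x. (U n x - U k x)\<^sup>2 \<partial>M) < \<delta> * d / 2"
      proof (cases "n \<le> k")
        case True
        then show ?thesis using S_diff[OF True] K[OF nk] by linarith
      next
        case False
        then have "(\<integral>x. (U k x - U n x)\<^sup>2 \<partial>M) \<le> S n - S k" by (intro S_diff) simp
        moreover have "(\<integral>x. (U n x - U k x)\<^sup>2 \<partial>M) = (\<integral>x. (U k x - U n x)\<^sup>2 \<partial>M)"
          by (simp add: power2_commute)
        ultimately show ?thesis using K[OF nk] by linarith
      qed
      have "(\<lambda>x. (U n x - U k x)\<^sup>2) = (\<lambda>x. (U n x)\<^sup>2 - 2 * (U n x * U k x) + (U k x)\<^sup>2)"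
        by (auto simp: power2_eq_square algebra_simps)
      then have int: "integrable M (\<lambda>x. (U n x - U k x)\<^sup>2)"
        using U2_int[of n] U2_int[of k] UU_int[of n k] by simp
      have "(\<integral>x. \<bar>U n x - U k x\<bar> \<partial>M) \<le> (\<integral>x. \<delta> + 1 / \<delta> * (U n x - U k x)\<^sup>2 \<partial>M)"
      proof (rule integral_mono)
        show "\<bar>U n x - U k x\<bar> \<le> \<delta> + 1 / \<delta> * (U n x - U k x)\<^sup>2" for x
        proof (cases "\<bar>U n x - U k x\<bar> \<le> \<delta>")
          case False
          then have "\<bar>U n x - U k x\<bar> * \<delta> \<le> \<bar>U n x - U k x\<bar> * \<bar>U n x - U k x\<bar>"
            by (intro mult_left_mono) auto
          then have "\<bar>U n x - U k x\<bar> \<le> (U n x - U k x)\<^sup>2 / \<delta>"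
            using \<delta> by (simp add: pos_le_divide_eq power2_eq_square)
          then show ?thesis using \<delta> by simp
        next
          case True
          moreover have "1 / \<delta> * (U n x - U k x)\<^sup>2 \<ge> 0" using \<delta> by simp
          ultimately show ?thesis by linarith
        qed
      qed (use U_int int in auto)
      also have "\<dots> = \<delta> * measure M (space M) + 1 / \<delta> * (\<integral>x. (U n x - U k x)\<^sup>2 \<partial>M)"
        using int by (simp add: mult.commute)
      also have "\<delta> * measure M (space M) \<le> \<delta> * c0"
        using \<delta> unfolding c0_def by (intro mult_left_mono) auto
      also have "\<delta> * c0 = d / 2" unfolding \<delta>_def using c0 by simp
      also have "1 / \<delta> * (\<integral>x. (U n x - U k x)\<^sup>2 \<partial>M) < 1 / \<delta> * (\<delta> * d / 2)"
        using L2 \<delta> by (intro mult_strict_left_mono) auto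
      also have "1 / \<delta> * (\<delta> * d / 2) = d / 2" using \<delta> by simp
      finally show ?thesis by simp
    qed
    then show ?thesis by blast
  qed
  have "\<exists>u. integrable M u \<and> (\<lambda>n. \<integral>x. \<bar>U n x - u x\<bar> \<partial>M) \<longlonglongrightarrow> 0"
    by (rule L1_complete[of M U, OF U_int]) (rule U_Cauchy)
  then obtain u where u: "integrable M u" "(\<lambda>n. \<integral>x. \<bar>U n x - u x\<bar> \<partial>M) \<longlonglongrightarrow> 0"
    by (elim exE conjE)
  \<comment> \<open>The limit \<open>v\<close> is defined from \<open>u\<close> by the resolvent
    equation equivalent to \<open>e * v + A v = f - u\<close>; accretivity then yields convergence
    of \<open>V n\<close> to \<open>v\<close>.\<close>
  obtain v where v: "v \<in> D" and v_eq: "AE x in M. v x + 1 / e * A v x = 1 / e * (f x - u x)"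
    using range[of "\<lambda>x. 1 / e * (f x - u x)" "1 / e"] f u(1) e by auto
  have V_lim: "(\<lambda>n. \<integral>x. \<bar>V n x - v x\<bar> \<partial>M) \<longlonglongrightarrow> 0"
  proof (rule tendsto_sandwich[OF _ _ tendsto_const])
    have "(\<integral>x. \<bar>V n x - v x\<bar> \<partial>M) \<le> 1 / e * (\<integral>x. \<bar>U n x - u x\<bar> \<partial>M)" for n
    proof -
      have "(\<integral>x. \<bar>V n x - v x\<bar> \<partial>M)
          \<le> (\<integral>x. \<bar>(V n x + 1 / e * A (V n) x) - (v x + 1 / e * A v x)\<bar> \<partial>M)"
        by (rule accretive_diff[OF V(1) v]) (use e in simp)
      also have "\<dots> = (\<integral>x. \<bar>- (1 / e * (U n x - u x))\<bar> \<partial>M)"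
      proof (rule AE_eq_integral_abs)
        show "AE x in M. (V n x + 1 / e * A (V n) x) - (v x + 1 / e * A v x) = - (1 / e * (U n x - u x))"
          using v_eq eq[of n]
        proof eventually_elim
          case (elim x)
          have "V n x + 1 / e * A (V n) x = 1 / e * (e * V n x + A (V n) x)"
            using e by (simp add: field_simps)
          also have "e * V n x + A (V n) x = f x - U n x" using elim(2) by linarith
          finally show ?case unfolding elim(1) by (simp add: algebra_simps)
        qed
      qed (use V(1) v U_int u D_simps in auto)
      also have "\<dots> = 1 / e * (\<integral>x. \<bar>U n x - u x\<bar> \<partial>M)"
        using e by (simp add: abs_mult)
      finally show ?thesis .
    qed
    then show "\<forall>\<^sub>F n in sequentially. (\<integral>x. \<bar>V n x - v x\<bar> \<partial>M) \<le> 1 / e * (\<integral>x. \<bar>U n x - u x\<bar> \<partial>M)" by simp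
    show "(\<lambda>n. 1 / e * (\<integral>x. \<bar>U n x - u x\<bar> \<partial>M)) \<longlonglongrightarrow> 0"
      using tendsto_mult_left[OF u(2), of "1 / e"] by simp
  qed simp
  \<comment> \<open>\<open>Y n\<close> differs from \<open>V n\<close> by \<open>l n * U n\<close>,
    which vanishes in the limit because the norms of \<open>U n\<close> stay bounded.\<close>
  have Y_lim: "(\<lambda>n. \<integral>x. \<bar>Y n x - v x\<bar> \<partial>M) \<longlonglongrightarrow> 0"
  proof (rule tendsto_sandwich[OF _ _ tendsto_const])
    have "(\<integral>x. \<bar>Y n x - v x\<bar> \<partial>M)
        \<le> (\<integral>x. \<bar>V n x - v x\<bar> \<partial>M) + l n * ((\<integral>x. \<bar>U n x - u x\<bar> \<partial>M) + (\<integral>x. \<bar>u x\<bar> \<partial>M))" for n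
    proof -
      have "(\<integral>x. \<bar>Y n x - v x\<bar> \<partial>M)
          \<le> (\<integral>x. \<bar>V n x - v x\<bar> + l n * (\<bar>U n x - u x\<bar> + \<bar>u x\<bar>) \<partial>M)"
      proof (rule integral_mono)
        fix x
        have "\<bar>Y n x - v x\<bar> \<le> \<bar>V n x - v x\<bar> + \<bar>l n * U n x\<bar>" by (simp add: V_eq)
        also have "\<bar>l n * U n x\<bar> \<le> l n * (\<bar>U n x - u x\<bar> + \<bar>u x\<bar>)"
          using l(1)[of n] by (simp add: abs_mult)
        finally show "\<bar>Y n x - v x\<bar> \<le> \<bar>V n x - v x\<bar> + l n * (\<bar>U n x - u x\<bar> + \<bar>u x\<bar>)" by simp
      qed (use Y_int V(1) v U_int u D_simps in auto)
      also have "\<dots> = (\<integral>x. \<bar>V n x - v x\<bar> \<partial>M) + l n * ((\<integral>x. \<bar>U n x - u x\<bar> \<partial>M) + (\<integral>x. \<bar>u x\<bar> \<partial>M))"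
        using V_int[of n] D_integrable[OF v] U_int[of n] u(1) by simp
      finally show ?thesis .
    qed
    then show "\<forall>\<^sub>F n in sequentially. (\<integral>x. \<bar>Y n x - v x\<bar> \<partial>M)
        \<le> (\<integral>x. \<bar>V n x - v x\<bar> \<partial>M) + l n * ((\<integral>x. \<bar>U n x - u x\<bar> \<partial>M) + (\<integral>x. \<bar>u x\<bar> \<partial>M))" by simp
    have "(\<lambda>n. (\<integral>x. \<bar>V n x - v x\<bar> \<partial>M) + l n * ((\<integral>x. \<bar>U n x - u x\<bar> \<partial>M) + (\<integral>x. \<bar>u x\<bar> \<partial>M)))
        \<longlonglongrightarrow> 0 + 0 * (0 + (\<integral>x. \<bar>u x\<bar> \<partial>M))"
      by (intro tendsto_intros V_lim u(2) l_lim)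
    then show "(\<lambda>n. (\<integral>x. \<bar>V n x - v x\<bar> \<partial>M) + l n * ((\<integral>x. \<bar>U n x - u x\<bar> \<partial>M) + (\<integral>x. \<bar>u x\<bar> \<partial>M))) \<longlonglongrightarrow> 0"
      by simp
  qed simp
  have "AE x in M. u x \<in> subdiff (p x) (v x)"
    by (rule subdiff_limit[OF U_int Y_int u(1) D_integrable[OF v] u(2) Y_lim sub])
  moreover have "AE x in M. e * v x + u x + A v x = f x"
    using v_eq
  proof eventually_elim
    case (elim x)
    then have "e * (v x + 1 / e * A v x) = e * (1 / e * (f x - u x))" by simp
    then show ?case using e by (simp add: algebra_simps)
  qed
  ultimately show ?thesis using v u(1) by blast
qed

section \<open>General data and uniqueness\<close>

lemma zero_subdiff: "x \<in> space M \<Longrightarrow> 0 \<in> subdiff (p x) 0"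
  using p_nonneg[of x] p_zero[of x] by (auto simp: subdiff_def)

lemma subdiff_mono_AE:
  assumes "AE x in M. u1 x \<in> subdiff (p x) (v1 x)" "AE x in M. u2 x \<in> subdiff (p x) (v2 x)"
  shows "AE x in M. (u1 x - u2 x) * (v1 x - v2 x) \<ge> 0"
  using assms by eventually_elim (rule subdiff_mono)

text \<open>Comparison with the zero solution, with \<open>u + e * v\<close> as the monotone term,
  bounds this term by the datum. Then \<open>A v\<close> is bounded by twice the datum, and
  coercivity gives a bound independent of \<open>e\<close>.\<close>

lemma perturbed_solution_bound:
  assumes e: "e \<ge> 0" and f: "integrable M f" and v: "v \<in> D" and u: "integrable M u"
    and eq: "AE x in M. e * v x + u x + A v x = f x" and sub: "AE x in M. u x \<in> subdiff (p x) (v x)"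
  shows "c * (\<integral>x. \<bar>v x\<bar> \<partial>M) \<le> 2 * (\<integral>x. \<bar>f x\<bar> \<partial>M)"
proof -
  have int: "integrable M (\<lambda>x. u x + e * v x)" using u v D_simps by auto
  have "(\<integral>x. \<bar>(u x + e * v x) - 0\<bar> \<partial>M) \<le> (\<integral>x. \<bar>f x - 0\<bar> \<partial>M)"
  proof (rule contraction[OF v zero_D f _ int])
    show "AE x in M. u x + e * v x + A v x = f x" using eq by eventually_elim simp
    show "AE x in M. 0 + A (\<lambda>x. 0) x = 0" using A_zero by simp
    show "AE x in M. (u x + e * v x - 0) * (v x - 0) \<ge> 0"
      using sub AE_space
    proof eventually_elim
      case (elim x)
      have "u x * v x \<ge> 0" using subdiff_mono[OF elim(1) zero_subdiff[OF elim(2)]] by simp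
      moreover have "e * (v x * v x) \<ge> 0" using e by simp
      ultimately show ?case by (simp add: algebra_simps)
    qed
  qed auto
  then have bd: "(\<integral>x. \<bar>u x + e * v x\<bar> \<partial>M) \<le> (\<integral>x. \<bar>f x\<bar> \<partial>M)" by simp
  have "c * (\<integral>x. \<bar>v x\<bar> \<partial>M) \<le> (\<integral>x. \<bar>A v x\<bar> \<partial>M)" by (rule coercive[OF v])
  also have "\<dots> \<le> (\<integral>x. \<bar>f x\<bar> + \<bar>u x + e * v x\<bar> \<partial>M)"
  proof (rule integral_mono_AE)
    show "AE x in M. \<bar>A v x\<bar> \<le> \<bar>f x\<bar> + \<bar>u x + e * v x\<bar>" using eq by eventually_elim auto
  qed (use v int f D_simps in auto)
  also have "\<dots> = (\<integral>x. \<bar>f x\<bar> \<partial>M) + (\<integral>x. \<bar>u x + e * v x\<bar> \<partial>M)"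
    by (rule Bochner_Integration.integral_add) (use int f in auto)
  finally show ?thesis using bd by simp
qed

text \<open>Truncation of \<open>f\<close> and the perturbation \<open>e\<close> are removed
  together: contraction makes \<open>U n\<close> Cauchy, coercivity makes \<open>V n\<close> Cauchy,
  and closedness of both graphs identifies the limits.\<close>

lemma solution_ex:
  assumes f: "integrable M f"
  shows "\<exists>v\<in>D. \<exists>u. integrable M u \<and> (AE x in M. u x + A v x = f x) \<and>
    (AE x in M. u x \<in> subdiff (p x) (v x))"
proof -
  define N where "N = (\<lambda>n. real (Suc n))"
  have N: "N n > 0" for n unfolding N_def by simp
  define F where "F = (\<lambda>n x. max (- N n) (min (N n) (f x)))"
  have F_int: "integrable M (F n)" for n unfolding F_def using f by auto
  have F_N: "AE x in M. \<bar>F n x\<bar> \<le> N n" for n unfolding F_def using N[of n] by (intro AE_I2) auto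
  have F_abs: "\<bar>F n x\<bar> \<le> \<bar>f x\<bar>" for n x unfolding F_def using N[of n] by auto
  have F_lim: "(\<lambda>n. \<integral>x. \<bar>F n x - f x\<bar> \<partial>M) \<longlonglongrightarrow> (\<integral>x. 0 \<partial>M)"
  proof (rule integral_dominated_convergence[where w = "\<lambda>x. 2 * \<bar>f x\<bar>"])
    show "AE x in M. (\<lambda>n. \<bar>F n x - f x\<bar>) \<longlonglongrightarrow> 0"
    proof (rule AE_I2, rule tendsto_eventually)
      fix x
      obtain k :: nat where "\<bar>f x\<bar> < real k" using reals_Archimedean2 by auto
      then have "\<bar>F n x - f x\<bar> = 0" if "n \<ge> k" for n
        using that unfolding F_def N_def by auto
      then show "\<forall>\<^sub>F n in sequentially. \<bar>F n x - f x\<bar> = 0" by (auto simp: eventually_sequentially)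
    qed
    show "AE x in M. norm \<bar>F n x - f x\<bar> \<le> 2 * \<bar>f x\<bar>" for n
    proof (rule AE_I2)
      fix x show "norm \<bar>F n x - f x\<bar> \<le> 2 * \<bar>f x\<bar>" using F_abs[of n x] by simp
    qed
  qed (use F_int f in auto)
  define e where "e = (\<lambda>n. 1 / real (Suc n))"
  have e: "e n > 0" for n unfolding e_def by simp
  have e_lim: "e \<longlonglongrightarrow> 0" unfolding e_def by (rule LIMSEQ_inverse_real_of_nat[unfolded inverse_eq_divide])
  have "\<forall>n. \<exists>v. v \<in> D \<and> (\<exists>u. integrable M u \<and> (AE x in M. e n * v x + u x + A v x = F n x) \<and>
      (AE x in M. u x \<in> subdiff (p x) (v x)))"
    using bounded_data_solution_ex[OF e F_int N F_N] by (simp add: Bex_def)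
  from choice[OF this] obtain V where V: "\<And>n. V n \<in> D" and
    "\<forall>n. \<exists>u. integrable M u \<and> (AE x in M. e n * V n x + u x + A (V n) x = F n x) \<and>
      (AE x in M. u x \<in> subdiff (p x) (V n x))"
    by auto
  from choice[OF this(2)] obtain U where U_int: "\<And>n. integrable M (U n)"
    and eq: "\<And>n. AE x in M. e n * V n x + U n x + A (V n) x = F n x"
    and sub: "\<And>n. AE x in M. U n x \<in> subdiff (p x) (V n x)"
    by auto
  note V_int = D_integrable[OF V]
  \<comment> \<open>The uniform bounds \<open>N n / e n\<close> of the approximations blow up, but
    coercivity keeps their \<open>L1\<close> norms below \<open>R\<close>.\<close>
  define R where "R = 2 * (\<integral>x. \<bar>f x\<bar> \<partial>M) / c"
  have V_bd: "(\<integral>x. \<bar>V n x\<bar> \<partial>M) \<le> R" for n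
  proof -
    have "c * (\<integral>x. \<bar>V n x\<bar> \<partial>M) \<le> 2 * (\<integral>x. \<bar>F n x\<bar> \<partial>M)"
      using e[of n] by (intro perturbed_solution_bound[OF _ F_int V U_int eq sub]) simp
    also have "(\<integral>x. \<bar>F n x\<bar> \<partial>M) \<le> (\<integral>x. \<bar>f x\<bar> \<partial>M)"
      by (rule integral_mono) (use F_int f F_abs in auto)
    finally show ?thesis unfolding R_def using c_pos by (simp add: field_simps)
  qed
  \<comment> \<open>Moving \<open>e n * V n\<close> into the datum leaves unperturbed equations
    whose data still converge to \<open>f\<close>.\<close>
  define g where "g = (\<lambda>n x. F n x - e n * V n x)"
  have g_int: "integrable M (g n)" for n unfolding g_def using F_int V_int by auto
  have g_eq: "AE x in M. U n x + A (V n) x = g n x" for n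
    using eq[of n] unfolding g_def by eventually_elim simp
  define a where "a = (\<lambda>n. (\<integral>x. \<bar>F n x - f x\<bar> \<partial>M) + e n * R)"
  have a_lim: "a \<longlonglongrightarrow> 0"
  proof -
    have "a \<longlonglongrightarrow> 0 + 0 * R" unfolding a_def
      by (intro tendsto_intros e_lim) (use F_lim in simp)
    then show ?thesis by simp
  qed
  have g_f: "(\<integral>x. \<bar>g n x - f x\<bar> \<partial>M) \<le> a n" for n
  proof -
    have "(\<integral>x. \<bar>g n x - f x\<bar> \<partial>M) \<le> (\<integral>x. \<bar>F n x - f x\<bar> + e n * \<bar>V n x\<bar> \<partial>M)"
    proof (rule integral_mono)
      fix x
      show "\<bar>g n x - f x\<bar> \<le> \<bar>F n x - f x\<bar> + e n * \<bar>V n x\<bar>"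
        using abs_triangle_ineq4[of "F n x - f x" "e n * V n x"] e[of n]
        unfolding g_def by (simp add: abs_mult algebra_simps)
    qed (use g_int F_int f V_int in auto)
    also have "\<dots> = (\<integral>x. \<bar>F n x - f x\<bar> \<partial>M) + e n * (\<integral>x. \<bar>V n x\<bar> \<partial>M)"
      using F_int[of n] f V_int[of n] by simp
    also have "\<dots> \<le> a n" unfolding a_def using V_bd[of n] e[of n] by simp
    finally show ?thesis .
  qed
  have g_g: "(\<integral>x. \<bar>g n x - g k x\<bar> \<partial>M) \<le> a n + a k" for n k
    using L1_triangle[OF g_int f g_int, of n k] L1_diff_commute[of M f "g k"] g_f[of n] g_f[of k]
    by linarith
  have U_U: "(\<integral>x. \<bar>U n x - U k x\<bar> \<partial>M) \<le> a n + a k" for n k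
    using contraction[OF V V g_int g_int U_int U_int g_eq g_eq subdiff_mono_AE[OF sub sub], of n k]
      g_g[of n k] by linarith
  from L1_limit_of_null_bound[of M U, OF U_int U_U a_lim]
  obtain u where u: "integrable M u" "(\<lambda>n. \<integral>x. \<bar>U n x - u x\<bar> \<partial>M) \<longlonglongrightarrow> 0"
    by (elim exE conjE)
  \<comment> \<open>Serves twice: with the data of another index it gives the Cauchy estimate for
    \<open>V n\<close>, and with \<open>f\<close> and \<open>u\<close> the limit of
    \<open>A (V n)\<close>.\<close>
  have A_g: "(\<integral>x. \<bar>A (V n) x - (h x - w x)\<bar> \<partial>M) \<le> (\<integral>x. \<bar>g n x - h x\<bar> \<partial>M) + (\<integral>x. \<bar>U n x - w x\<bar> \<partial>M)"
    if h: "integrable M h" and w: "integrable M w" for n h w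
  proof -
    have "(\<integral>x. \<bar>A (V n) x - (h x - w x)\<bar> \<partial>M) \<le> (\<integral>x. \<bar>g n x - h x\<bar> + \<bar>U n x - w x\<bar> \<partial>M)"
    proof (rule integral_mono_AE)
      show "AE x in M. \<bar>A (V n) x - (h x - w x)\<bar> \<le> \<bar>g n x - h x\<bar> + \<bar>U n x - w x\<bar>"
        using g_eq[of n] by eventually_elim auto
    qed (use V D_simps h w g_int U_int in auto)
    also have "\<dots> = (\<integral>x. \<bar>g n x - h x\<bar> \<partial>M) + (\<integral>x. \<bar>U n x - w x\<bar> \<partial>M)"
      by (rule Bochner_Integration.integral_add) (use h w g_int U_int in auto)
    finally show ?thesis .
  qed
  have V_V: "(\<integral>x. \<bar>V n x - V k x\<bar> \<partial>M) \<le> 2 / c * a n + 2 / c * a k" for n k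
  proof -
    have "c * (\<integral>x. \<bar>V n x - V k x\<bar> \<partial>M) \<le> (\<integral>x. \<bar>A (V n) x - A (V k) x\<bar> \<partial>M)"
      by (rule coercive_diff[OF V V])
    also have "\<dots> = (\<integral>x. \<bar>A (V n) x - (g k x - U k x)\<bar> \<partial>M)"
    proof (rule AE_eq_integral_abs)
      show "AE x in M. A (V n) x - A (V k) x = A (V n) x - (g k x - U k x)"
        using g_eq[of k] by eventually_elim simp
    qed (use V D_simps g_int U_int in auto)
    also have "\<dots> \<le> (\<integral>x. \<bar>g n x - g k x\<bar> \<partial>M) + (\<integral>x. \<bar>U n x - U k x\<bar> \<partial>M)"
      by (rule A_g[OF g_int U_int])
    also have "\<dots> \<le> (a n + a k) + (a n + a k)"
      by (rule add_mono[OF g_g U_U])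
    finally show ?thesis using c_pos by (simp add: field_simps)
  qed
  have "(\<lambda>n. 2 / c * a n) \<longlonglongrightarrow> 0" using tendsto_mult_left[OF a_lim, of "2 / c"] by simp
  from L1_limit_of_null_bound[of M V, OF V_int V_V this]
  obtain v where v: "integrable M v" "(\<lambda>n. \<integral>x. \<bar>V n x - v x\<bar> \<partial>M) \<longlonglongrightarrow> 0"
    by (elim exE conjE)
  have A_lim: "(\<lambda>n. \<integral>x. \<bar>A (V n) x - (f x - u x)\<bar> \<partial>M) \<longlonglongrightarrow> 0"
  proof (rule tendsto_sandwich[OF _ _ tendsto_const])
    show "\<forall>\<^sub>F n in sequentially. (\<integral>x. \<bar>A (V n) x - (f x - u x)\<bar> \<partial>M) \<le> a n + (\<integral>x. \<bar>U n x - u x\<bar> \<partial>M)"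
    proof (rule always_eventually, rule allI)
      fix n
      show "(\<integral>x. \<bar>A (V n) x - (f x - u x)\<bar> \<partial>M) \<le> a n + (\<integral>x. \<bar>U n x - u x\<bar> \<partial>M)"
        using A_g[OF f u(1), of n] g_f[of n] by linarith
    qed
    show "(\<lambda>n. a n + (\<integral>x. \<bar>U n x - u x\<bar> \<partial>M)) \<longlonglongrightarrow> 0"
      using tendsto_add[OF a_lim u(2)] by simp
  qed simp
  have "integrable M (\<lambda>x. f x - u x)" using f u(1) by auto
  from closed[OF V v(1) this v(2) A_lim] have "v \<in> D" and Av: "AE x in M. A v x = f x - u x" by auto
  moreover have "AE x in M. u x + A v x = f x" using Av by eventually_elim simp
  moreover have "AE x in M. u x \<in> subdiff (p x) (v x)"
    by (rule subdiff_limit[OF U_int V_int u(1) v(1) u(2) v(2) sub])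
  ultimately show ?thesis using u(1) by blast
qed

text \<open>Contraction settles the \<open>u\<close> components; then \<open>A v1\<close> and
  \<open>A v2\<close> agree, and coercivity settles the \<open>v\<close> components.\<close>

lemma solution_unique:
  assumes v: "v1 \<in> D" "v2 \<in> D" and int: "integrable M f" "integrable M u1" "integrable M u2"
    and eq: "AE x in M. u1 x + A v1 x = f x" "AE x in M. u2 x + A v2 x = f x"
    and sub: "AE x in M. u1 x \<in> subdiff (p x) (v1 x)" "AE x in M. u2 x \<in> subdiff (p x) (v2 x)"
  shows "AE x in M. u1 x = u2 x" "AE x in M. v1 x = v2 x"
proof -
  have "(\<integral>x. \<bar>u1 x - u2 x\<bar> \<partial>M) \<le> (\<integral>x. \<bar>f x - f x\<bar> \<partial>M)"
    by (rule contraction[OF v int(1,1,2,3) eq subdiff_mono_AE[OF sub]])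
  then show u: "AE x in M. u1 x = u2 x" by (intro L1_zero_AE_eq int) simp
  have "(\<integral>x. \<bar>A v1 x - A v2 x\<bar> \<partial>M) = (\<integral>x. \<bar>0\<bar> \<partial>M)"
  proof (rule AE_eq_integral_abs)
    show "AE x in M. A v1 x - A v2 x = 0" using u eq by eventually_elim simp
  qed (use v D_simps in auto)
  then have "c * (\<integral>x. \<bar>v1 x - v2 x\<bar> \<partial>M) \<le> 0" using coercive_diff[OF v] by simp
  then have "(\<integral>x. \<bar>v1 x - v2 x\<bar> \<partial>M) \<le> 0" using c_pos by (simp add: mult_le_0_iff)
  then show "AE x in M. v1 x = v2 x" by (intro L1_zero_AE_eq D_integrable v)
qed

end

section \<open>Operators on a bounded open set\<close>

lemma subgradient_eq_subdiff:
  assumes "\<forall>\<xi>. f \<xi> \<in> {0..<\<infinity>}"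
  shows "subgradient f v = subdiff (\<lambda>\<xi>. real_of_ereal (f \<xi>)) v"
proof -
  have "f \<xi> = ereal (real_of_ereal (f \<xi>))" for \<xi>
    using assms[rule_format, of \<xi>] by (cases "f \<xi>") auto
  then obtain q where q: "f = (\<lambda>\<xi>. ereal (q \<xi>))" using that[of "\<lambda>\<xi>. real_of_ereal (f \<xi>)"] by auto
  show ?thesis unfolding subgradient_def subdiff_def q by simp
qed

lemma convex_on_real_of_ereal:
  assumes "\<forall>\<xi>. f \<xi> \<in> {0..<\<infinity>}" and cvx: "convex_ereal f"
  shows "convex_on UNIV (\<lambda>\<xi>. real_of_ereal (f \<xi>))"
proof -
  have "f \<xi> = ereal (real_of_ereal (f \<xi>))" for \<xi>
    using assms(1)[rule_format, of \<xi>] by (cases "f \<xi>") auto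
  then obtain q where q: "f = (\<lambda>\<xi>. ereal (q \<xi>))" using that[of "\<lambda>\<xi>. real_of_ereal (f \<xi>)"] by auto
  show ?thesis
  proof (rule convex_onI)
    fix t x y :: real assume "0 < t" "t < 1"
    with cvx have "f ((1 - t) * x + t * y) \<le> ereal (1 - t) * f x + ereal t * f y"
      unfolding convex_ereal_def by blast
    then show "real_of_ereal (f ((1 - t) *\<^sub>R x + t *\<^sub>R y))
        \<le> (1 - t) * real_of_ereal (f x) + t * real_of_ereal (f y)"
      unfolding q by simp
  qed simp
qed

lemma subgradient_bound_square_integrable:
  assumes "nonneg_L2 G (subgradient_bound \<phi> C)"
  defines "m \<equiv> \<lambda>x. enn2real (subgradient_bound \<phi> C x)"
  shows "integrable (lebesgue_on G) (\<lambda>x. (m x)\<^sup>2)"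
    and "AE x in lebesgue_on G. \<forall>v u. u \<in> subgradient (\<phi> x) v \<longrightarrow> \<bar>v\<bar> \<le> C \<longrightarrow> \<bar>u\<bar> \<le> m x"
proof -
  let ?B = "subgradient_bound \<phi> C"
  have [measurable]: "?B \<in> borel_measurable (lebesgue_on G)"
    and fin: "(\<integral>\<^sup>+ x. (?B x)\<^sup>2 \<partial>lebesgue_on G) < \<infinity>"
    using assms(1) unfolding nonneg_L2_def by auto
  show "integrable (lebesgue_on G) (\<lambda>x. (m x)\<^sup>2)"
  proof (rule integrableI_bounded)
    show "(\<lambda>x. (m x)\<^sup>2) \<in> borel_measurable (lebesgue_on G)" unfolding m_def by measurable
    have "(\<integral>\<^sup>+ x. ennreal (norm ((m x)\<^sup>2)) \<partial>lebesgue_on G) \<le> (\<integral>\<^sup>+ x. (?B x)\<^sup>2 \<partial>lebesgue_on G)"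
    proof (rule nn_integral_mono)
      fix x
      show "ennreal (norm ((m x)\<^sup>2)) \<le> (?B x)\<^sup>2"
        unfolding m_def by (cases "?B x") (auto simp: ennreal_power)
    qed
    also note fin
    finally show "(\<integral>\<^sup>+ x. ennreal (norm ((m x)\<^sup>2)) \<partial>lebesgue_on G) < \<infinity>" .
  qed
  \<comment> \<open>A function whose square has finite integral is finite almost everywhere, so the
    default value 0 of \<open>enn2real\<close> at infinity affects only a null set.\<close>
  have "AE x in lebesgue_on G. (?B x)\<^sup>2 \<noteq> \<infinity>"
    using fin by (intro nn_integral_PInf_AE) auto
  then show "AE x in lebesgue_on G. \<forall>v u. u \<in> subgradient (\<phi> x) v \<longrightarrow> \<bar>v\<bar> \<le> C \<longrightarrow> \<bar>u\<bar> \<le> m x"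
  proof eventually_elim
    case (elim x)
    then have "?B x \<noteq> \<infinity>" by (auto simp: power2_eq_square ennreal_mult_eq_top_iff)
    then have m: "?B x = ennreal (m x)" unfolding m_def by (simp add: less_top)
    show ?case
    proof safe
      fix v u assume "u \<in> subgradient (\<phi> x) v" "\<bar>v\<bar> \<le> C"
      then have "ennreal \<bar>u\<bar> \<le> ?B x" unfolding subgradient_bound_def by (intro Sup_upper) blast
      then show "\<bar>u\<bar> \<le> m x" unfolding m by (simp add: m_def)
    qed
  qed
qed

lemma L1_operator_lebesgue_on:
  fixes G :: "'a::euclidean_space set"
  assumes G: "open G" "bounded G"
    and lin: "linear_operator_L1 G D A" and dense: "dense_L1 G D"
    and res: "\<forall>r>0. resolvent_contraction_L1 G D A r"
    and c: "c > 0" "\<forall>v\<in>D. c * L1norm G v \<le> L1norm G (A v)"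
    and sup: "\<forall>f\<in>L1 G. \<forall>r>0. \<forall>v. resolvent_L1 G D A r f v \<longrightarrow>
           esssup (lebesgue_on G) (\<lambda>x. ereal (v x))
             \<le> max (esssup (lebesgue_on G) (\<lambda>x. ereal (f x))) 0"
  shows "L1_operator (lebesgue_on G) D A c"
proof -
  let ?M = "lebesgue_on G"
  have D_int: "integrable ?M v" and A_int: "integrable ?M (A v)" if "v \<in> D" for v
    using lin that unfolding linear_operator_L1_def L1_def by blast+
  have scale: "(\<lambda>x. a * v x) \<in> D" "AE x in ?M. A (\<lambda>x. a * v x) x = a * A v x" if "v \<in> D" for a v
    using lin that unfolding linear_operator_L1_def eq_L1_def by blast+
  have add: "(\<lambda>x. v x + w x) \<in> D" "AE x in ?M. A (\<lambda>x. v x + w x) x = A v x + A w x"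
    if "v \<in> D" "w \<in> D" for v w
    using lin that unfolding linear_operator_L1_def eq_L1_def by blast+
  have zero: "(\<lambda>x. 0) \<in> D" using lin unfolding linear_operator_L1_def by blast
  have A_zero: "AE x in ?M. A (\<lambda>x. 0) x = 0" using scale(2)[OF zero, of 0] by simp
  have data: "(\<lambda>x. v x + r * A v x) \<in> L1 G" "resolvent_L1 G D A r (\<lambda>x. v x + r * A v x) v"
    if "v \<in> D" for r v
    using that D_int A_int by (auto simp: L1_def resolvent_L1_def eq_L1_def)
  show ?thesis
  proof (intro L1_operator.intro L1_operator_axioms.intro)
    show "finite_measure ?M"
      using G by (intro finite_measure_lebesgue_on lmeasurable_open)
  next
    fix v w :: "'a \<Rightarrow> real" assume "v \<in> D" "integrable ?M w" "AE x in ?M. v x = w x"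
    then show "w \<in> D" "AE x in ?M. A v x = A w x"
      using lin unfolding linear_operator_L1_def eq_L1_def L1_def by blast+
  next
    fix v w a b assume v: "v \<in> D" "w \<in> D"
    show "(\<lambda>x. a * v x + b * w x) \<in> D" by (intro add(1) scale(1) v)
    show "AE x in ?M. A (\<lambda>x. a * v x + b * w x) x = a * A v x + b * A w x"
      using add(2)[OF scale(1)[OF v(1)] scale(1)[OF v(2)], of a b] scale(2)[OF v(1), of a] scale(2)[OF v(2), of b]
      by eventually_elim simp
  next
    fix f :: "'a \<Rightarrow> real" and e :: real assume "integrable ?M f" "e > 0"
    then show "\<exists>v\<in>D. (\<integral>x. \<bar>f x - v x\<bar> \<partial>?M) < e"
      using dense unfolding dense_L1_def L1_def L1norm_def by blast
  next
    fix f :: "'a \<Rightarrow> real" and r :: real assume "integrable ?M f" "r > 0"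
    then show "\<exists>v\<in>D. AE x in ?M. v x + r * A v x = f x"
      using res unfolding resolvent_contraction_L1_def resolvent_L1_def eq_L1_def L1_def by blast
  next
    fix v and r :: real assume v: "v \<in> D" and r: "r > 0"
    \<comment> \<open>Zero is its own resolvent by linearity, so nonexpansiveness specialises to a
      norm bound for a single element.\<close>
    have "resolvent_L1 G D A r (\<lambda>x. 0) (\<lambda>x. 0)"
      unfolding resolvent_L1_def eq_L1_def using zero A_zero by auto
    moreover have "(\<lambda>x. 0) \<in> L1 G" by (simp add: L1_def)
    ultimately have "L1norm G (\<lambda>x. v x - 0) \<le> L1norm G (\<lambda>x. v x + r * A v x - 0)"
      using res r data[OF v, of r] unfolding resolvent_contraction_L1_def by blast
    then show "(\<integral>x. \<bar>v x\<bar> \<partial>?M) \<le> (\<integral>x. \<bar>v x + r * A v x\<bar> \<partial>?M)" unfolding L1norm_def by simp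
  next
    fix v and r t :: real
    assume v: "v \<in> D" and r: "r > 0" and t: "t \<ge> 0" and le: "AE x in ?M. v x + r * A v x \<le> t"
    have meas: "(\<lambda>x. ereal (v x + r * A v x)) \<in> borel_measurable ?M"
      using data(1)[OF v, of r] by (auto simp: L1_def)
    \<comment> \<open>The datum is bounded by \<open>t \<ge> 0\<close>, which absorbs the maximum
      with zero.\<close>
    have "esssup ?M (\<lambda>x. ereal (v x)) \<le> max (esssup ?M (\<lambda>x. ereal (v x + r * A v x))) 0"
      using sup data[OF v, of r] r by blast
    moreover have "esssup ?M (\<lambda>x. ereal (v x + r * A v x)) \<le> ereal t"
      using le by (intro esssup_I meas) simp
    moreover have "0 \<le> ereal t" using t by simp
    ultimately have bd: "esssup ?M (\<lambda>x. ereal (v x)) \<le> ereal t"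
      by (meson max.boundedI order.trans)
    have "AE x in ?M. ereal (v x) \<le> esssup ?M (\<lambda>x. ereal (v x))" by (rule esssup_AE)
    then show "AE x in ?M. v x \<le> t"
    proof eventually_elim
      case (elim x)
      from order.trans[OF this bd] show ?case by simp
    qed
  qed (use D_int A_int c in \<open>auto simp: L1norm_def\<close>)
qed

theorem theorem4p3:
  fixes G :: "(real ^ 'n) set"
    and \<phi> :: "real ^ 'n \<Rightarrow> real \<Rightarrow> ereal"
    and D :: "(real ^ 'n \<Rightarrow> real) set"
    and A :: "(real ^ 'n \<Rightarrow> real) \<Rightarrow> real ^ 'n \<Rightarrow> real"
  assumes "open G" and "bounded G"
    and "measurable_convex_integrand G \<phi>"
    and "\<forall>x\<in>G. \<forall>\<xi>. \<phi> x \<xi> \<in> {0..<\<infinity>}"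
    and "\<forall>x\<in>G. \<phi> x 0 = 0"
    and "\<forall>C>0. nonneg_L2 G (subgradient_bound \<phi> C)"
    and "linear_operator_L1 G D A"
    and "dense_L1 G D"
    and "\<forall>r>0. resolvent_contraction_L1 G D A r"
    and "\<exists>c>0. \<forall>v\<in>D. c * L1norm G v \<le> L1norm G (A v)"
    and "\<forall>f\<in>L1 G. \<forall>r>0. \<forall>v. resolvent_L1 G D A r f v \<longrightarrow>
           esssup (lebesgue_on G) (\<lambda>x. ereal (v x))
             \<le> max (esssup (lebesgue_on G) (\<lambda>x. ereal (f x))) 0"
  shows "(\<forall>f\<in>L1 G. \<exists>u v. solves G \<phi> D A f u v \<and>
            (\<forall>u' v'. solves G \<phi> D A f u' v' \<longrightarrow> eq_L1 G u' u \<and> eq_L1 G v' v)) \<and>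
         (\<forall>f\<^sub>1\<in>L1 G. \<forall>f\<^sub>2\<in>L1 G. \<forall>u\<^sub>1 v\<^sub>1 u\<^sub>2 v\<^sub>2.
            solves G \<phi> D A f\<^sub>1 u\<^sub>1 v\<^sub>1 \<and> solves G \<phi> D A f\<^sub>2 u\<^sub>2 v\<^sub>2 \<longrightarrow>
              L1norm G (\<lambda>x. max (u\<^sub>1 x - u\<^sub>2 x) 0) \<le> L1norm G (\<lambda>x. max (f\<^sub>1 x - f\<^sub>2 x) 0) \<and>
              L1norm G (\<lambda>x. max (- (u\<^sub>1 x - u\<^sub>2 x)) 0) \<le> L1norm G (\<lambda>x. max (- (f\<^sub>1 x - f\<^sub>2 x)) 0) \<and>
              L1norm G (\<lambda>x. u\<^sub>1 x - u\<^sub>2 x) \<le> L1norm G (\<lambda>x. f\<^sub>1 x - f\<^sub>2 x))"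
proof -
  let ?M = "lebesgue_on G"
  define p where "p = (\<lambda>x \<xi>. real_of_ereal (\<phi> x \<xi>))"
  have sub_eq: "subgradient (\<phi> x) v = subdiff (p x) v" if "x \<in> space ?M" for x v
    unfolding p_def using assms(4) that by (intro subgradient_eq_subdiff) simp
  obtain c where "c > 0" "\<forall>v\<in>D. c * L1norm G v \<le> L1norm G (A v)" using assms(10) by blast
  then interpret L1_operator ?M D A c
    by (intro L1_operator_lebesgue_on assms)
  interpret L1_convex_problem ?M D A c p
  proof
    fix x assume "x \<in> space ?M"
    then have x: "x \<in> G" by simp
    show "convex_on UNIV (p x)"
      unfolding p_def using assms(3,4) x
      by (intro convex_on_real_of_ereal) (auto simp: measurable_convex_integrand_def)
    show "p x s \<ge> 0" for s
      unfolding p_def using assms(4) x by (intro real_of_ereal_pos) simp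
    show "p x 0 = 0" unfolding p_def using assms(5) x by simp
  next
    fix s
    have "(\<lambda>x. \<phi> x s) \<in> borel_measurable ?M"
      using assms(3) unfolding measurable_convex_integrand_def by blast
    then show "(\<lambda>x. p x s) \<in> borel_measurable ?M" unfolding p_def by measurable
  next
    fix C :: real assume "C > 0"
    with assms(6) have "nonneg_L2 G (subgradient_bound \<phi> C)" by blast
    note m = subgradient_bound_square_integrable[OF this]
    have "AE x in ?M. \<forall>v u. u \<in> subdiff (p x) v \<longrightarrow> \<bar>v\<bar> \<le> C \<longrightarrow> \<bar>u\<bar> \<le> enn2real (subgradient_bound \<phi> C x)"
      using m(2) AE_space by eventually_elim (simp add: sub_eq)
    with m(1) show "\<exists>m. integrable ?M (\<lambda>x. (m x)\<^sup>2) \<and>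
        (AE x in ?M. \<forall>v u. u \<in> subdiff (p x) v \<longrightarrow> \<bar>v\<bar> \<le> C \<longrightarrow> \<bar>u\<bar> \<le> m x)"
      by (intro exI[of _ "\<lambda>x. enn2real (subgradient_bound \<phi> C x)"] conjI)
  qed
  have AE_sub: "(AE x in ?M. u x \<in> subgradient (\<phi> x) (v x)) \<longleftrightarrow> (AE x in ?M. u x \<in> subdiff (p x) (v x))"
    for u v by (rule AE_cong) (simp add: sub_eq)
  have solves: "solves G \<phi> D A f u v \<longleftrightarrow> v \<in> D \<and> integrable ?M u \<and>
      (AE x in ?M. u x + A v x = f x) \<and> (AE x in ?M. u x \<in> subdiff (p x) (v x))" for f u v
    unfolding solves_def AE_sub by (simp add: L1_def eq_L1_def)
  show ?thesis
  proof (intro conjI ballI)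
    fix f assume "f \<in> L1 G"
    then have f: "integrable ?M f" by (simp add: L1_def)
    from solution_ex[OF f] obtain v u where "v \<in> D" "integrable ?M u"
      "AE x in ?M. u x + A v x = f x" "AE x in ?M. u x \<in> subdiff (p x) (v x)"
      by (elim bexE exE conjE)
    then have uv: "solves G \<phi> D A f u v" unfolding solves by simp
    have "eq_L1 G u' u \<and> eq_L1 G v' v" if "solves G \<phi> D A f u' v'" for u' v'
      using uv that solution_unique[OF _ _ f, of v' v u' u] unfolding solves eq_L1_def by simp
    with uv show "\<exists>u v. solves G \<phi> D A f u v \<and>
        (\<forall>u' v'. solves G \<phi> D A f u' v' \<longrightarrow> eq_L1 G u' u \<and> eq_L1 G v' v)" by blast
  next
    fix f1 f2 assume "f1 \<in> L1 G" "f2 \<in> L1 G"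
    then have f: "integrable ?M f1" "integrable ?M f2" by (simp_all add: L1_def)
    show "\<forall>u1 v1 u2 v2. solves G \<phi> D A f1 u1 v1 \<and> solves G \<phi> D A f2 u2 v2 \<longrightarrow>
        L1norm G (\<lambda>x. max (u1 x - u2 x) 0) \<le> L1norm G (\<lambda>x. max (f1 x - f2 x) 0) \<and>
        L1norm G (\<lambda>x. max (- (u1 x - u2 x)) 0) \<le> L1norm G (\<lambda>x. max (- (f1 x - f2 x)) 0) \<and>
        L1norm G (\<lambda>x. u1 x - u2 x) \<le> L1norm G (\<lambda>x. f1 x - f2 x)"
    proof (intro allI impI)
      fix u1 v1 u2 v2
      assume sol: "solves G \<phi> D A f1 u1 v1 \<and> solves G \<phi> D A f2 u2 v2"
      then have v: "v1 \<in> D" "v2 \<in> D" and u: "integrable ?M u1" "integrable ?M u2"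
        and eq: "AE x in ?M. u1 x + A v1 x = f1 x" "AE x in ?M. u2 x + A v2 x = f2 x"
        and sub: "AE x in ?M. u1 x \<in> subdiff (p x) (v1 x)" "AE x in ?M. u2 x \<in> subdiff (p x) (v2 x)"
        unfolding solves by auto
      \<comment> \<open>The bound for negative parts is the comparison with the two solutions
        exchanged.\<close>
      show "L1norm G (\<lambda>x. max (u1 x - u2 x) 0) \<le> L1norm G (\<lambda>x. max (f1 x - f2 x) 0) \<and>
          L1norm G (\<lambda>x. max (- (u1 x - u2 x)) 0) \<le> L1norm G (\<lambda>x. max (- (f1 x - f2 x)) 0) \<and>
          L1norm G (\<lambda>x. u1 x - u2 x) \<le> L1norm G (\<lambda>x. f1 x - f2 x)"
        using comparison[OF v f u eq subdiff_mono_AE[OF sub]]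
          comparison[OF v(2,1) f(2,1) u(2,1) eq(2,1) subdiff_mono_AE[OF sub(2,1)]]
          contraction[OF v f u eq subdiff_mono_AE[OF sub]]
        unfolding L1norm_def by simp
    qed
  qed
qed

end
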